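(* Let $\mathcal{F}=[F_\varepsilon]\subseteq\mathcal{G}_E$ be an internal $\widetilde{\mathbb{R}}$-submodule, where each $F_\varepsilon\subseteq E_\varepsilon$ is a vector subspace, and let $g=[g_\varepsilon]:\mathcal{F}\to\widetilde{\mathbb{R}}$ be an $\widetilde{\mathbb{R}}$-linear map (with representatives). Assume that there exist $i\in\mathbb{N}$ and $C\in\widetilde{\mathbb{R}}_{>0}$ such that $g$ is well defined on $\mathcal{F}_i$ and $$\forall x\in\mathcal{F}_i:\ g(x)\le C\,p_i(x).$$ Then there exists an $\widetilde{\mathbb{R}}$-linear map $f=[f_\varepsilon]:\mathcal{G}_{E_i}\to\widetilde{\mathbb{R}}$ (with representatives) that extends $g$, i.e. $f(x)=g(x)$ for all $x\in\mathcal{F}_i$, and satisfies $$\forall x\in\mathcal{G}_{E_i}:\ f(x)\le C\,p_i(x).$$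
   Context: Let $I=(0,1]$ and fix a gauge, i.e. a net $\rho=(\rho_\varepsilon)\in I^I$ with $\rho_\varepsilon\to0$ as $\varepsilon\to0^+$. All asymptotic relations are for $\varepsilon\to0^+$. $E=(E_\varepsilon,(p_{\varepsilon n})_{n\in\mathbb{N}})_{\varepsilon\in I}$ is a family of real locally convex topological vector spaces, the topology of $E_\varepsilon$ being defined by the seminorms $(p_{\varepsilon n})_{n\in\mathbb{N}}$. For $J\subseteq\mathbb{N}$ let $E_J=(E_\varepsilon,(p_{\varepsilon n})_{n\in J})$ and $\mathcal{M}_{E_J}=\{(u_\varepsilon)\in\prod_\varepsilon E_\varepsilon\mid\forall n\in J\,\exists N\in\mathbb{N}:p_{\varepsilon n}(u_\varepsilon)=O(\rho_\varepsilon^{-N})\}$, $\mathcal{N}_{E_J}=\{(u_\varepsilon)\in\prod_\varepsilon E_\varepsilon\mid\forall n\in J\,\forall N\in\mathbb{N}:p_{\varepsilon n}(u_\varepsilon)=O(\rho_\varepsilon^{N})\}$, $\mathcal{G}_{E_J}=\mathcal{M}_{E_J}/\mathcal{N}_{E_J}$, with classes $[u_\varepsilon]$; $\mathcal{G}_E=\mathcal{G}_{E_{\mathbb{N}}}$, and $E_i:=E_{\{i\}}$. Every element of $\mathcal{G}_E$ defines an element of $\mathcal{G}_{E_J}$. The ring $\widetilde{\mathbb{R}}$ is obtained with $E_\varepsilon=\mathbb{R}$ (moderate and negligible nets $\mathcal{M}_{\mathbb{R}},\mathcal{N}_{\mathbb{R}}$); $\mathcal{G}_{E_J}$ is an $\widetilde{\mathbb{R}}$-module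 with componentwise operations. Order on $\widetilde{\mathbb{R}}$: $x\le y$ iff for any representative $(x_\varepsilon)$ of $x$ there is a representative $(y_\varepsilon)$ of $y$ with $x_\varepsilon\le y_\varepsilon$ for all sufficiently small $\varepsilon$; $x>0$ iff $x\ge0$ and $x$ is invertible. $p_i(u)=[p_{\varepsilon i}(u_\varepsilon)]\in\widetilde{\mathbb{R}}$ for $u=[u_\varepsilon]$. $\mathcal{F}=[F_\varepsilon]$ is the set of $u\in\mathcal{G}_E$ having a representative with $u_\varepsilon\in F_\varepsilon$ for all $\varepsilon$ small; $\mathcal{F}_i$ is the set of $u\in\mathcal{G}_{E_i}$ having a representative with $u_\varepsilon\in F_\varepsilon$ for all $\varepsilon$ small. $g=[g_\varepsilon]$ on $\mathcal{F}$ means: $g_\varepsilon:F_\varepsilon\to\mathbb{R}$ are linear, $(g_\varepsilon(u_\varepsilon))\in\mathcal{M}_{\mathbb{R}}$ for all $(u_\varepsilon)\in\mathcal{M}_E\cap\prod_\varepsilon F_\varepsilon$, $(g_\varepsilon(u_\varepsilon)-g_\varepsilon(v_\varepsilon))\in\mathcal{N}_{\mathbb{R}}$ for such nets with $(u_\varepsilon-v_\varepsilon)\in\mathcal{N}_E$, and $g([u_\varepsilon])=[g_\varepsilon(u_\varepsilon)]$. "$g$ is well defined on $\mathcal{F}_i$" means that the same conditions hold with $E_i$ in place of $E$, so that $g([u_\varepsilon])=[g_\varepsilon(u_\varepsilon)]$ defines a map on $\mathcal{F}_i$. $f=[f_\varepsilon]:\mathcal{G}_{E_i}\to\widetilde{\mathbb{R}}$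 means the same with linear maps $f_\varepsilon:E_\varepsilon\to\mathbb{R}$ and all nets in $\mathcal{M}_{E_i}$. *)

theory Defs
  imports Complex_Main "HOL-Library.Landau_Symbols" "HOL-Algebra.QuotRing" "HOL-Algebra.Module"
begin

section \<open>Families of seminormed spaces\<close>

abbreviation ind :: "real set" where
  "ind \<equiv> {0<..1}"

definition gauge :: "(real \<Rightarrow> real) \<Rightarrow> bool" where
  "gauge \<rho> \<longleftrightarrow> \<rho> \<in> ind \<rightarrow> ind \<and> (\<rho> \<longlongrightarrow> 0) (at_right 0)"

definition seminorm_on :: "'a::real_vector set \<Rightarrow> ('a \<Rightarrow> real) \<Rightarrow> bool" where
  "seminorm_on S q \<longleftrightarrow>
     (\<forall>x\<in>S. 0 \<le> q x) \<and>
     (\<forall>x\<in>S. \<forall>y\<in>S. q (x + y) \<le> q x + q y) \<and>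
     (\<forall>c. \<forall>x\<in>S. q (c *\<^sub>R x) = \<bar>c\<bar> * q x)"

definition linear_functional_on :: "'a::real_vector set \<Rightarrow> ('a \<Rightarrow> real) \<Rightarrow> bool" where
  "linear_functional_on S h \<longleftrightarrow>
     (\<forall>x\<in>S. \<forall>y\<in>S. h (x + y) = h x + h y) \<and>
     (\<forall>c. \<forall>x\<in>S. h (c *\<^sub>R x) = c * h x)"

text \<open>
  A family of locally convex spaces is given by vector spaces \<open>E \<epsilon>\<close> and seminorms
  \<open>p \<epsilon> n\<close>; the locally convex topology of \<open>E \<epsilon>\<close> is the one the seminorms generate,
  so it is not a separate datum. The spaces \<open>E \<epsilon>\<close> are subspaces of one ambient real vector
  space, on which nothing else is assumed. This is no restriction: every family of vector spaces
  embeds into its direct sum.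
\<close>

definition lc_family :: "(real \<Rightarrow> 'a::real_vector set) \<Rightarrow> (real \<Rightarrow> nat \<Rightarrow> 'a \<Rightarrow> real) \<Rightarrow> bool" where
  "lc_family E p \<longleftrightarrow> (\<forall>\<epsilon>\<in>ind. subspace (E \<epsilon>) \<and> (\<forall>n. seminorm_on (E \<epsilon>) (p \<epsilon> n)))"


section \<open>Moderate and negligible nets\<close>

text \<open>
  Nets are functions on all of \<^typ>\<open>real\<close> whose values outside the index interval are irrelevant:
  two nets that agree on the interval have a negligible difference and thus the same class.
\<close>

definition moderate ::
  "(real \<Rightarrow> real) \<Rightarrow> (real \<Rightarrow> 'a::real_vector set) \<Rightarrow> (real \<Rightarrow> nat \<Rightarrow> 'a \<Rightarrow> real) \<Rightarrow> nat set
    \<Rightarrow> (real \<Rightarrow> 'a) set" where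
  "moderate \<rho> E p J =
     {u \<in> Pi ind E. \<forall>n\<in>J. \<exists>N::nat. (\<lambda>\<epsilon>. p \<epsilon> n (u \<epsilon>)) \<in> O[at_right 0](\<lambda>\<epsilon>. 1 / \<rho> \<epsilon> ^ N)}"

definition negligible ::
  "(real \<Rightarrow> real) \<Rightarrow> (real \<Rightarrow> 'a::real_vector set) \<Rightarrow> (real \<Rightarrow> nat \<Rightarrow> 'a \<Rightarrow> real) \<Rightarrow> nat set
    \<Rightarrow> (real \<Rightarrow> 'a) set" where
  "negligible \<rho> E p J =
     {u \<in> Pi ind E. \<forall>n\<in>J. \<forall>N::nat. (\<lambda>\<epsilon>. p \<epsilon> n (u \<epsilon>)) \<in> O[at_right 0](\<lambda>\<epsilon>. \<rho> \<epsilon> ^ N)}"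

abbreviation moderate_real :: "(real \<Rightarrow> real) \<Rightarrow> (real \<Rightarrow> real) set" where
  "moderate_real \<rho> \<equiv> moderate \<rho> (\<lambda>_. UNIV) (\<lambda>_ _ x. \<bar>x\<bar>) UNIV"

abbreviation negligible_real :: "(real \<Rightarrow> real) \<Rightarrow> (real \<Rightarrow> real) set" where
  "negligible_real \<rho> \<equiv> negligible \<rho> (\<lambda>_. UNIV) (\<lambda>_ _ x. \<bar>x\<bar>) UNIV"


section \<open>The ring of generalized real numbers\<close>

definition moderate_ring :: "(real \<Rightarrow> real) \<Rightarrow> (real \<Rightarrow> real) ring" where
  "moderate_ring \<rho> =
     \<lparr>carrier = moderate_real \<rho>, mult = (\<lambda>x y \<epsilon>. x \<epsilon> * y \<epsilon>), one = (\<lambda>_. 1),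
      zero = (\<lambda>_. 0), add = (\<lambda>x y \<epsilon>. x \<epsilon> + y \<epsilon>)\<rparr>"

definition gen_real :: "(real \<Rightarrow> real) \<Rightarrow> (real \<Rightarrow> real) set ring" where
  "gen_real \<rho> = moderate_ring \<rho> Quot negligible_real \<rho>"

definition gen_real_class :: "(real \<Rightarrow> real) \<Rightarrow> (real \<Rightarrow> real) \<Rightarrow> (real \<Rightarrow> real) set" where
  "gen_real_class \<rho> x = negligible_real \<rho> +>\<^bsub>moderate_ring \<rho>\<^esub> x"

text \<open>Generalized numbers are sets of nets, namely of all their representatives.\<close>

definition gen_le :: "(real \<Rightarrow> real) set \<Rightarrow> (real \<Rightarrow> real) set \<Rightarrow> bool" where
  "gen_le x y \<longleftrightarrow> (\<forall>a\<in>x. \<exists>b\<in>y. eventually (\<lambda>\<epsilon>. a \<epsilon> \<le> b \<epsilon>) (at_right 0))"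

definition gen_pos :: "(real \<Rightarrow> real) \<Rightarrow> (real \<Rightarrow> real) set \<Rightarrow> bool" where
  "gen_pos \<rho> x \<longleftrightarrow> gen_le \<zero>\<^bsub>gen_real \<rho>\<^esub> x \<and> x \<in> Units (gen_real \<rho>)"


section \<open>The modules of generalized functions\<close>

text \<open>
  Module records of HOL-Algebra extend ring records; their fields \<open>mult\<close> and \<open>one\<close> play no
  role in the module structure.
\<close>

definition moderate_module ::
  "(real \<Rightarrow> real) \<Rightarrow> (real \<Rightarrow> 'a::real_vector set) \<Rightarrow> (real \<Rightarrow> nat \<Rightarrow> 'a \<Rightarrow> real) \<Rightarrow> nat set
    \<Rightarrow> (real \<Rightarrow> real, real \<Rightarrow> 'a) module" where
  "moderate_module \<rho> E p J =
     \<lparr>carrier = moderate \<rho> E p J, mult = (\<lambda>_ _. undefined), one = undefined,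
      zero = (\<lambda>_. 0), add = (\<lambda>u v \<epsilon>. u \<epsilon> + v \<epsilon>), smult = (\<lambda>a u \<epsilon>. a \<epsilon> *\<^sub>R u \<epsilon>)\<rparr>"

definition gen_class ::
  "(real \<Rightarrow> real) \<Rightarrow> (real \<Rightarrow> 'a::real_vector set) \<Rightarrow> (real \<Rightarrow> nat \<Rightarrow> 'a \<Rightarrow> real) \<Rightarrow> nat set
    \<Rightarrow> (real \<Rightarrow> 'a) \<Rightarrow> (real \<Rightarrow> 'a) set" where
  "gen_class \<rho> E p J u = negligible \<rho> E p J +>\<^bsub>moderate_module \<rho> E p J\<^esub> u"

text \<open>As in the library's quotient ring, operations are unions over all representatives.\<close>

definition gen_module ::
  "(real \<Rightarrow> real) \<Rightarrow> (real \<Rightarrow> 'a::real_vector set) \<Rightarrow> (real \<Rightarrow> nat \<Rightarrow> 'a \<Rightarrow> real) \<Rightarrow> nat set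
    \<Rightarrow> ((real \<Rightarrow> real) set, (real \<Rightarrow> 'a) set) module" where
  "gen_module \<rho> E p J =
     \<lparr>carrier = a_rcosets\<^bsub>moderate_module \<rho> E p J\<^esub> (negligible \<rho> E p J),
      mult = (\<lambda>_ _. undefined), one = undefined,
      zero = negligible \<rho> E p J,
      add = set_add (moderate_module \<rho> E p J),
      smult = (\<lambda>x y. \<Union>a\<in>x. \<Union>u\<in>y. gen_class \<rho> E p J (a \<odot>\<^bsub>moderate_module \<rho> E p J\<^esub> u))\<rparr>"

definition gen_seminorm ::
  "(real \<Rightarrow> real) \<Rightarrow> (real \<Rightarrow> nat \<Rightarrow> 'a::real_vector \<Rightarrow> real) \<Rightarrow> nat
    \<Rightarrow> (real \<Rightarrow> 'a) set \<Rightarrow> (real \<Rightarrow> real) set" where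
  "gen_seminorm \<rho> p i x = (\<Union>u\<in>x. gen_real_class \<rho> (\<lambda>\<epsilon>. p \<epsilon> i (u \<epsilon>)))"

definition gen_linear_on ::
  "(real \<Rightarrow> real) \<Rightarrow> ((real \<Rightarrow> real) set, 'm) module \<Rightarrow> 'm set
    \<Rightarrow> ('m \<Rightarrow> (real \<Rightarrow> real) set) \<Rightarrow> bool" where
  "gen_linear_on \<rho> M X h \<longleftrightarrow>
     h \<in> X \<rightarrow> carrier (gen_real \<rho>) \<and>
     (\<forall>x\<in>X. \<forall>y\<in>X. h (x \<oplus>\<^bsub>M\<^esub> y) = h x \<oplus>\<^bsub>gen_real \<rho>\<^esub> h y) \<and>
     (\<forall>a\<in>carrier (gen_real \<rho>). \<forall>x\<in>X. h (a \<odot>\<^bsub>M\<^esub> x) = a \<otimes>\<^bsub>gen_real \<rho>\<^esub> h x)"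


section \<open>Internal sets and maps given by representatives\<close>

definition internal ::
  "(real \<Rightarrow> real) \<Rightarrow> (real \<Rightarrow> 'a::real_vector set) \<Rightarrow> (real \<Rightarrow> nat \<Rightarrow> 'a \<Rightarrow> real) \<Rightarrow> nat set
    \<Rightarrow> (real \<Rightarrow> 'a set) \<Rightarrow> (real \<Rightarrow> 'a) set set" where
  "internal \<rho> E p J F =
     {x \<in> carrier (gen_module \<rho> E p J). \<exists>u\<in>x. eventually (\<lambda>\<epsilon>. u \<epsilon> \<in> F \<epsilon>) (at_right 0)}"

text \<open>
  The map \<open>h\<close> on the internal set of the \<open>F \<epsilon>\<close> is (well) defined by the linear representatives
  \<open>hr \<epsilon>\<close> on \<open>F \<epsilon>\<close>. Values of \<open>h\<close> outside that internal set are unconstrained.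
\<close>

definition represented_by ::
  "(real \<Rightarrow> real) \<Rightarrow> (real \<Rightarrow> 'a::real_vector set) \<Rightarrow> (real \<Rightarrow> nat \<Rightarrow> 'a \<Rightarrow> real) \<Rightarrow> nat set
    \<Rightarrow> (real \<Rightarrow> 'a set) \<Rightarrow> (real \<Rightarrow> 'a \<Rightarrow> real) \<Rightarrow> ((real \<Rightarrow> 'a) set \<Rightarrow> (real \<Rightarrow> real) set) \<Rightarrow> bool" where
  "represented_by \<rho> E p J F hr h \<longleftrightarrow>
     (\<forall>\<epsilon>\<in>ind. linear_functional_on (F \<epsilon>) (hr \<epsilon>)) \<and>
     (\<forall>u\<in>moderate \<rho> E p J \<inter> Pi ind F. (\<lambda>\<epsilon>. hr \<epsilon> (u \<epsilon>)) \<in> moderate_real \<rho>) \<and>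
     (\<forall>u\<in>moderate \<rho> E p J \<inter> Pi ind F. \<forall>v\<in>moderate \<rho> E p J \<inter> Pi ind F.
        (\<lambda>\<epsilon>. u \<epsilon> - v \<epsilon>) \<in> negligible \<rho> E p J \<longrightarrow>
        (\<lambda>\<epsilon>. hr \<epsilon> (u \<epsilon>) - hr \<epsilon> (v \<epsilon>)) \<in> negligible_real \<rho>) \<and>
     (\<forall>u\<in>moderate \<rho> E p J \<inter> Pi ind F.
        h (gen_class \<rho> E p J u) = gen_real_class \<rho> (\<lambda>\<epsilon>. hr \<epsilon> (u \<epsilon>)))"

end

theory Submission
  imports Defs "HOL-Analysis.Product_Vector"
begin

text \<open>
  Let \<open>b \<epsilon>\<close> be the supremum of \<open>g \<epsilon>\<close> on the unit ball of \<open>p \<epsilon> i\<close> in \<open>F \<epsilon>\<close>, that is, the norm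
  of \<open>g \<epsilon>\<close>. Gluing together vectors that violate a bound at individual indices turns the
  inequality for generalized points into the uniform statement that, for every \<open>m\<close>,
  \<open>b \<epsilon> \<le> c \<epsilon> + \<rho> \<epsilon> ^ m\<close> for small \<open>\<epsilon>\<close>, where \<open>c\<close> represents \<open>C\<close>. So the excess of \<open>b\<close> over \<open>c\<close>
  is negligible, and Hahn-Banach extensions of the \<open>g \<epsilon>\<close> dominated by \<open>b \<epsilon> * p \<epsilon> i\<close> represent
  the required map.
\<close>

section \<open>Hahn-Banach extension dominated by a seminorm\<close>

text \<open>Zorn's lemma is applied to graphs: a partial functional is a subspace of the product
  with the reals that lies over \<open>E\<close> and below \<open>q\<close>. Linearity is then
  closure under the subspace operations, and unions of chains and the adjunction of a new direction
  are plain set constructions.\<close>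

lemma Hahn_Banach_seminorm:
  fixes E F :: "'a::real_vector set"
  assumes E: "subspace E" and F: "subspace F" "F \<subseteq> E" and q: "seminorm_on E q"
    and g: "linear_functional_on F g" "\<And>x. x \<in> F \<Longrightarrow> g x \<le> q x"
  obtains f where "linear_functional_on E f" "\<And>x. x \<in> F \<Longrightarrow> f x = g x" "\<And>x. x \<in> E \<Longrightarrow> f x \<le> q x"
proof -
  define G where "G = (\<lambda>x. (x, g x)) ` F"
  define \<A> where "\<A> = {H :: ('a \<times> real) set. subspace H \<and> G \<subseteq> H \<and> (\<forall>x r. (x, r) \<in> H \<longrightarrow> x \<in> E \<and> r \<le> q x)}"
  have g_add: "g (x + y) = g x + g y" if "x \<in> F" "y \<in> F" for x y
    using g(1) that by (auto simp: linear_functional_on_def)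
  have g_scale: "g (c *\<^sub>R x) = c * g x" if "x \<in> F" for x c
    using g(1) that by (auto simp: linear_functional_on_def)
  have q_add: "q (x + y) \<le> q x + q y" if "x \<in> E" "y \<in> E" for x y
    using q that by (auto simp: seminorm_on_def)
  have q_scale: "q (c *\<^sub>R x) = \<bar>c\<bar> * q x" if "x \<in> E" for x c
    using q that by (auto simp: seminorm_on_def)
  have "subspace G"
    unfolding subspace_def
  proof (intro conjI ballI allI)
    have "g 0 = 0" using g_scale[of 0 0] subspace_0[OF F(1)] by simp
    then show "0 \<in> G" using subspace_0[OF F(1)] by (force simp: G_def zero_prod_def)
  qed (auto simp: G_def image_iff g_add g_scale F subspace_add subspace_scale)
  then have "G \<in> \<A>" using F(2) g(2) by (auto simp: \<A>_def G_def)
  have "\<exists>M\<in>\<A>. \<forall>X\<in>\<A>. M \<subseteq> X \<longrightarrow> X = M"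
  proof (rule subset_Zorn_nonempty)
    show "\<A> \<noteq> {}" using \<open>G \<in> \<A>\<close> by blast
    fix \<C> assume \<C>: "\<C> \<noteq> {}" "subset.chain \<A> \<C>"
    then have in\<A>: "H \<in> \<A>" if "H \<in> \<C>" for H
      using that by (auto simp: subset.chain_def)
    have common: "\<exists>H\<in>\<C>. a \<in> H \<and> b \<in> H" if "a \<in> \<Union>\<C>" "b \<in> \<Union>\<C>" for a b
      using that \<C>(2) unfolding subset_chain_def by blast
    have "subspace (\<Union>\<C>)"
      unfolding subspace_def
    proof (intro conjI ballI allI)
      show "0 \<in> \<Union>\<C>" using \<C>(1) in\<A> subspace_0 unfolding \<A>_def by blast
    next
      fix a b assume "a \<in> \<Union>\<C>" "b \<in> \<Union>\<C>"
      from common[OF this] show "a + b \<in> \<Union>\<C>"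
        using in\<A> subspace_add unfolding \<A>_def by blast
    next
      fix c a assume "a \<in> \<Union>\<C>"
      then show "c *\<^sub>R a \<in> \<Union>\<C>"
        using in\<A> subspace_scale unfolding \<A>_def by blast
    qed
    then show "\<Union>\<C> \<in> \<A>" using in\<A> \<C>(1) unfolding \<A>_def by blast
  qed
  then obtain M where M: "M \<in> \<A>" and max: "\<And>X. X \<in> \<A> \<Longrightarrow> M \<subseteq> X \<Longrightarrow> X = M"
    by blast
  have sM: "subspace M" and GM: "G \<subseteq> M" and ME: "\<And>x r. (x, r) \<in> M \<Longrightarrow> x \<in> E"
    and Mq: "\<And>x r. (x, r) \<in> M \<Longrightarrow> r \<le> q x"
    using M by (auto simp: \<A>_def)
  have M_add: "(x + y, r + s) \<in> M" if "(x, r) \<in> M" "(y, s) \<in> M" for x y r s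
    using subspace_add[OF sM that] by simp
  have M_scale: "(c *\<^sub>R x, c * r) \<in> M" if "(x, r) \<in> M" for c x r
    using subspace_scale[OF sM that, of c] by simp
  have M0: "(0, 0) \<in> M"
    using subspace_0[OF sM] by (simp add: zero_prod_def)
  \<comment> \<open>Adjoining \<open>x0\<close> with a suitable value \<open>a\<close> yields a
    member of \<open>\<A>\<close> that contains \<open>M\<close>; by maximality the pair
    \<open>(x0, a)\<close> already lies in \<open>M\<close>.\<close>
  have total: "\<exists>r. (x0, r) \<in> M" if x0: "x0 \<in> E" for x0
  proof -
    \<comment> \<open>Domination in the directions \<open>- x0\<close> and \<open>x0\<close> bounds
      the value at \<open>x0\<close> from below and from above. Subadditivity of \<open>q\<close>
      puts every lower bound below every upper one, so the supremum of the lower bounds satisfies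
      both.\<close>
    have cross: "r - q (x - x0) \<le> q (y + x0) - s" if "(x, r) \<in> M" "(y, s) \<in> M" for x y r s
    proof -
      have "r + s \<le> q (x + y)" using Mq[OF M_add[OF that]] .
      also have "x + y = (x - x0) + (y + x0)" by simp
      also have "q \<dots> \<le> q (x - x0) + q (y + x0)"
        using that ME x0 E by (intro q_add subspace_diff subspace_add) auto
      finally show ?thesis by simp
    qed
    define S where "S = (\<lambda>(x, r). r - q (x - x0)) ` M"
    define a where "a = Sup S"
    have "S \<noteq> {}" using M0 by (auto simp: S_def)
    have "bdd_above S"
      unfolding S_def using cross[OF _ M0] by (intro bdd_aboveI2[where M = "q (0 + x0) - 0"]) auto
    then have lower: "r - q (x - x0) \<le> a" if "(x, r) \<in> M" for x r
      unfolding a_def using that by (intro cSup_upper) (force simp: S_def)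
    have upper: "a \<le> q (y + x0) - s" if "(y, s) \<in> M" for y s
      unfolding a_def using cross that \<open>S \<noteq> {}\<close> by (intro cSup_least) (auto simp: S_def)
    \<comment> \<open>There is no case split on whether \<open>x0\<close> already lies under
      \<open>M\<close>: in either case \<open>H\<close> is a subspace below
      \<open>q\<close>.\<close>
    define H where "H = {(x + t *\<^sub>R x0, r + t * a) | x r t. (x, r) \<in> M}"
    have bound: "r + t * a \<le> q (x + t *\<^sub>R x0)" if xr: "(x, r) \<in> M" for x r t
    proof -
      \<comment> \<open>For nonzero \<open>t\<close>, scaling by \<open>1 / \<bar>t\<bar>\<close>
        reduces the claim to coefficient \<open>1\<close> or \<open>- 1\<close>, which is
        \<open>upper\<close> or \<open>lower\<close>.\<close>
      consider "t = 0" | "t > 0" | "t < 0" by linarith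
      then show ?thesis
      proof cases
        case 1
        then show ?thesis using Mq[OF xr] by simp
      next
        case 2
        have "t * a \<le> t * (q ((1 / t) *\<^sub>R x + x0) - (1 / t) * r)"
          using upper[OF M_scale[OF xr, of "1 / t"]] 2 by (intro mult_left_mono) auto
        also have "\<dots> = q (t *\<^sub>R ((1 / t) *\<^sub>R x + x0)) - r"
          using 2 ME[OF xr] x0 E
          by (subst q_scale) (auto simp: algebra_simps subspace_add subspace_scale)
        also have "t *\<^sub>R ((1 / t) *\<^sub>R x + x0) = x + t *\<^sub>R x0"
          using 2 by (simp add: algebra_simps)
        finally show ?thesis by simp
      next
        case 3
        have "(- t) * ((1 / (- t)) * r - q ((1 / (- t)) *\<^sub>R x - x0)) \<le> (- t) * a"
          using lower[OF M_scale[OF xr, of "1 / (- t)"]] 3 by (intro mult_left_mono) auto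
        moreover have "(- t) * q ((1 / (- t)) *\<^sub>R x - x0) = q ((- t) *\<^sub>R ((1 / (- t)) *\<^sub>R x - x0))"
          using 3 ME[OF xr] x0 E by (subst q_scale) (auto intro!: subspace_diff subspace_scale subspace_neg)
        moreover have "(- t) *\<^sub>R ((1 / (- t)) *\<^sub>R x - x0) = x + t *\<^sub>R x0"
          using 3 by (simp add: algebra_simps)
        ultimately show ?thesis using 3 by (simp add: algebra_simps)
      qed
    qed
    have "M \<subseteq> H"
    proof
      fix z assume "z \<in> M"
      then show "z \<in> H" unfolding H_def by (cases z) (force intro: exI[of _ "0::real"])
    qed
    have "subspace H"
      unfolding subspace_def
    proof (intro conjI ballI allI)
      show "0 \<in> H" using \<open>M \<subseteq> H\<close> subspace_0[OF sM] by blast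
    next
      fix z w assume "z \<in> H" "w \<in> H"
      then obtain x r t y s u where "(x, r) \<in> M" "z = (x + t *\<^sub>R x0, r + t * a)"
        "(y, s) \<in> M" "w = (y + u *\<^sub>R x0, s + u * a)"
        unfolding H_def by blast
      then have "(x + y, r + s) \<in> M" "z + w = ((x + y) + (t + u) *\<^sub>R x0, (r + s) + (t + u) * a)"
        using M_add by (auto simp: algebra_simps)
      then show "z + w \<in> H" unfolding H_def by blast
    next
      fix c z assume "z \<in> H"
      then obtain x r t where "(x, r) \<in> M" "z = (x + t *\<^sub>R x0, r + t * a)"
        unfolding H_def by blast
      then have "(c *\<^sub>R x, c * r) \<in> M" "c *\<^sub>R z = (c *\<^sub>R x + (c * t) *\<^sub>R x0, c * r + (c * t) * a)"
        using M_scale[of x r c] by (auto simp: algebra_simps)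
      then show "c *\<^sub>R z \<in> H" unfolding H_def by blast
    qed
    moreover have "x \<in> E \<and> r \<le> q x" if "(x, r) \<in> H" for x r
      using that bound ME x0 E by (auto simp: H_def intro!: subspace_add subspace_scale)
    ultimately have "H \<in> \<A>" using GM \<open>M \<subseteq> H\<close> by (auto simp: \<A>_def)
    then have "H = M" using max \<open>M \<subseteq> H\<close> by blast
    moreover have "(0 + 1 *\<^sub>R x0, 0 + 1 * a) \<in> H" unfolding H_def using M0 by blast
    ultimately show ?thesis by auto
  qed
  \<comment> \<open>Domination makes \<open>M\<close> single-valued: the difference of two pairs
    over \<open>x\<close> is a pair over \<open>0\<close>, where \<open>q\<close> vanishes.\<close>
  have unique: "r = s" if "(x, r) \<in> M" "(x, s) \<in> M" for x r s
  proof -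
    have "q 0 = 0" using q_scale[of 0 0] subspace_0[OF E] by simp
    then have le: "r \<le> s" if "(x, r) \<in> M" "(x, s) \<in> M" for r s
      using Mq[OF M_add[OF that(1) M_scale[OF that(2), of "- 1"]]] by simp
    show ?thesis using le[of r s] le[of s r] that by simp
  qed
  define f where "f x = (THE r. (x, r) \<in> M)" for x
  have f_eq: "f x = r" if "(x, r) \<in> M" for x r
    unfolding f_def using that unique by blast
  have f_in: "(x, f x) \<in> M" if "x \<in> E" for x
    using total[OF that] f_eq by auto
  show ?thesis
  proof
    show "linear_functional_on E f"
      unfolding linear_functional_on_def by (auto intro!: f_eq M_add M_scale f_in)
    show "f x = g x" if "x \<in> F" for x
      using GM that by (intro f_eq) (auto simp: G_def)
    show "f x \<le> q x" if "x \<in> E" for x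
      using Mq[OF f_in[OF that]] .
  qed
qed

section \<open>Moderate and negligible nets of real numbers\<close>

lemma eventually_ind: "eventually (\<lambda>\<epsilon>. \<epsilon> \<in> ind) (at_right 0)"
  unfolding eventually_at_right_field by (rule exI[of _ 1]) auto

text \<open>This growth condition and the next one concern a single scalar net. Applied to the
  values \<open>p \<epsilon> n (u \<epsilon>)\<close>, they reduce questions about vector-valued
  nets to a calculus of real nets.\<close>

definition mod_net :: "(real \<Rightarrow> real) \<Rightarrow> (real \<Rightarrow> real) \<Rightarrow> bool" where
  "mod_net \<rho> a \<longleftrightarrow> (\<exists>N::nat. a \<in> O[at_right 0](\<lambda>\<epsilon>. 1 / \<rho> \<epsilon> ^ N))"

definition negl_net :: "(real \<Rightarrow> real) \<Rightarrow> (real \<Rightarrow> real) \<Rightarrow> bool" where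
  "negl_net \<rho> a \<longleftrightarrow> (\<forall>N::nat. a \<in> O[at_right 0](\<lambda>\<epsilon>. \<rho> \<epsilon> ^ N))"

lemma negl_net_abs [simp]: "negl_net \<rho> (\<lambda>\<epsilon>. \<bar>a \<epsilon>\<bar>) \<longleftrightarrow> negl_net \<rho> a"
  by (simp add: negl_net_def)

lemma mod_net_abs [simp]: "mod_net \<rho> (\<lambda>\<epsilon>. \<bar>a \<epsilon>\<bar>) \<longleftrightarrow> mod_net \<rho> a"
  by (simp add: mod_net_def)

lemma moderate_iff:
  "u \<in> moderate \<rho> E p J \<longleftrightarrow> u \<in> Pi ind E \<and> (\<forall>n\<in>J. mod_net \<rho> (\<lambda>\<epsilon>. p \<epsilon> n (u \<epsilon>)))"
  by (simp add: moderate_def mod_net_def)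

lemma negligible_iff:
  "u \<in> negligible \<rho> E p J \<longleftrightarrow> u \<in> Pi ind E \<and> (\<forall>n\<in>J. negl_net \<rho> (\<lambda>\<epsilon>. p \<epsilon> n (u \<epsilon>)))"
  by (simp add: negligible_def negl_net_def)

lemma moderate_real_iff [simp]: "a \<in> moderate_real \<rho> \<longleftrightarrow> mod_net \<rho> a"
  by (simp add: moderate_iff)

lemma negligible_real_iff [simp]: "a \<in> negligible_real \<rho> \<longleftrightarrow> negl_net \<rho> a"
  by (simp add: negligible_iff)

lemma negl_net_add:
  assumes "negl_net \<rho> a" "negl_net \<rho> b"
  shows "negl_net \<rho> (\<lambda>\<epsilon>. a \<epsilon> + b \<epsilon>)"
  using assms by (auto simp: negl_net_def intro: sum_in_bigo)

lemma negl_net_mono: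
  assumes "negl_net \<rho> b" "eventually (\<lambda>\<epsilon>. \<bar>a \<epsilon>\<bar> \<le> b \<epsilon>) (at_right 0)"
  shows "negl_net \<rho> a"
  unfolding negl_net_def
proof
  fix N :: nat
  have "a \<in> O[at_right 0](b)"
    using assms(2) by (intro bigoI[of _ 1]) (auto elim!: eventually_mono)
  also have "b \<in> O[at_right 0](\<lambda>\<epsilon>. \<rho> \<epsilon> ^ N)"
    using assms(1) by (simp add: negl_net_def)
  finally show "a \<in> O[at_right 0](\<lambda>\<epsilon>. \<rho> \<epsilon> ^ N)" .
qed

lemma mod_net_mono:
  assumes "mod_net \<rho> b" "eventually (\<lambda>\<epsilon>. \<bar>a \<epsilon>\<bar> \<le> b \<epsilon>) (at_right 0)"
  shows "mod_net \<rho> a"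
proof -
  obtain N where N: "b \<in> O[at_right 0](\<lambda>\<epsilon>. 1 / \<rho> \<epsilon> ^ N)"
    using assms(1) by (auto simp: mod_net_def)
  have "a \<in> O[at_right 0](b)"
    using assms(2) by (intro bigoI[of _ 1]) (auto elim!: eventually_mono)
  also note N
  finally show ?thesis by (auto simp: mod_net_def)
qed

lemma mod_net_const: "mod_net \<rho> (\<lambda>_. c)"
  unfolding mod_net_def by (rule exI[of _ 0]) simp

lemma mod_net_mult:
  assumes "mod_net \<rho> a" "mod_net \<rho> b"
  shows "mod_net \<rho> (\<lambda>\<epsilon>. a \<epsilon> * b \<epsilon>)"
proof -
  obtain M N where "a \<in> O[at_right 0](\<lambda>\<epsilon>. 1 / \<rho> \<epsilon> ^ M)" "b \<in> O[at_right 0](\<lambda>\<epsilon>. 1 / \<rho> \<epsilon> ^ N)"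
    using assms by (auto simp: mod_net_def)
  from landau_o.big.mult[OF this] show ?thesis
    unfolding mod_net_def by (intro exI[of _ "M + N"]) (simp add: power_add)
qed

lemma negl_net_0: "negl_net \<rho> (\<lambda>_. 0)"
  by (simp add: negl_net_def)

lemma negl_net_mod_net:
  assumes "negl_net \<rho> a"
  shows "mod_net \<rho> a"
  unfolding mod_net_def using assms by (auto simp: negl_net_def intro!: exI[of _ 0] dest: spec[of _ 0])

locale gauged =
  fixes \<rho> :: "real \<Rightarrow> real"
  assumes gauge: "gauge \<rho>"
begin

lemma gauge_range: "\<epsilon> \<in> ind \<Longrightarrow> 0 < \<rho> \<epsilon> \<and> \<rho> \<epsilon> \<le> 1"
  using gauge by (auto simp: gauge_def Pi_iff)

lemma eventually_gauge: "eventually (\<lambda>\<epsilon>. 0 < \<rho> \<epsilon> \<and> \<rho> \<epsilon> \<le> 1) (at_right 0)"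
  using eventually_ind by eventually_elim (rule gauge_range)

text \<open>Both estimates are brought to the common exponent \<open>M + N\<close>; since
  \<open>\<rho> \<epsilon> \<le> 1\<close>, a larger exponent only weakens them.\<close>

lemma mod_net_add:
  assumes "mod_net \<rho> a" "mod_net \<rho> b"
  shows "mod_net \<rho> (\<lambda>\<epsilon>. a \<epsilon> + b \<epsilon>)"
proof -
  obtain M N where MN: "a \<in> O[at_right 0](\<lambda>\<epsilon>. 1 / \<rho> \<epsilon> ^ M)" "b \<in> O[at_right 0](\<lambda>\<epsilon>. 1 / \<rho> \<epsilon> ^ N)"
    using assms by (auto simp: mod_net_def)
  have "(\<lambda>\<epsilon>. 1 / \<rho> \<epsilon> ^ k) \<in> O[at_right 0](\<lambda>\<epsilon>. 1 / \<rho> \<epsilon> ^ (M + N))" if "k \<le> M + N" for k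
  proof (rule bigoI[of _ 1])
    show "\<forall>\<^sub>F \<epsilon> in at_right 0. norm (1 / \<rho> \<epsilon> ^ k) \<le> 1 * norm (1 / \<rho> \<epsilon> ^ (M + N))"
      using eventually_gauge
      by eventually_elim (auto intro!: divide_left_mono power_decreasing that)
  qed
  from this[of M] this[of N] MN have "a \<in> O[at_right 0](\<lambda>\<epsilon>. 1 / \<rho> \<epsilon> ^ (M + N))"
    "b \<in> O[at_right 0](\<lambda>\<epsilon>. 1 / \<rho> \<epsilon> ^ (M + N))"
    by (auto intro: landau_o.big_trans)
  from sum_in_bigo(1)[OF this] show ?thesis by (auto simp: mod_net_def)
qed

text \<open>The moderate factor costs a fixed power \<open>M\<close> of \<open>\<rho>\<close>, which
  is paid for by using the negligible factor with exponent \<open>N + M\<close>.\<close>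

lemma negl_net_mult:
  assumes "negl_net \<rho> a" "mod_net \<rho> b"
  shows "negl_net \<rho> (\<lambda>\<epsilon>. a \<epsilon> * b \<epsilon>)"
  unfolding negl_net_def
proof
  fix N :: nat
  obtain M where "b \<in> O[at_right 0](\<lambda>\<epsilon>. 1 / \<rho> \<epsilon> ^ M)"
    using assms by (auto simp: mod_net_def)
  moreover have "a \<in> O[at_right 0](\<lambda>\<epsilon>. \<rho> \<epsilon> ^ (N + M))"
    using assms(1) unfolding negl_net_def by blast
  ultimately have "(\<lambda>\<epsilon>. a \<epsilon> * b \<epsilon>) \<in> O[at_right 0](\<lambda>\<epsilon>. \<rho> \<epsilon> ^ (N + M) * (1 / \<rho> \<epsilon> ^ M))"
    by (intro landau_o.big.mult)
  also have "(\<lambda>\<epsilon>. \<rho> \<epsilon> ^ (N + M) * (1 / \<rho> \<epsilon> ^ M)) \<in> \<Theta>[at_right 0](\<lambda>\<epsilon>. \<rho> \<epsilon> ^ N)"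
    by (intro bigthetaI_cong eventually_mono[OF eventually_gauge]) (auto simp: power_add)
  finally show "(\<lambda>\<epsilon>. a \<epsilon> * b \<epsilon>) \<in> O[at_right 0](\<lambda>\<epsilon>. \<rho> \<epsilon> ^ N)" .
qed

text \<open>The big-O estimate is used with exponent \<open>Suc N\<close>: since
  \<open>\<rho>\<close> tends to zero, the extra factor \<open>\<rho> \<epsilon>\<close> eventually
  absorbs the constant.\<close>

lemma eventually_negl_net_le:
  assumes "negl_net \<rho> a"
  shows "eventually (\<lambda>\<epsilon>. \<bar>a \<epsilon>\<bar> \<le> \<rho> \<epsilon> ^ N) (at_right 0)"
proof -
  have "a \<in> O[at_right 0](\<lambda>\<epsilon>. \<rho> \<epsilon> ^ Suc N)"
    using assms unfolding negl_net_def by blast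
  then obtain c where c: "c > 0"
    "eventually (\<lambda>\<epsilon>. norm (a \<epsilon>) \<le> c * norm (\<rho> \<epsilon> ^ Suc N)) (at_right 0)"
    by (auto elim: landau_o.bigE)
  have "eventually (\<lambda>\<epsilon>. \<rho> \<epsilon> < 1 / c) (at_right 0)"
    using gauge c(1) by (intro order_tendstoD(2)[of _ 0]) (auto simp: gauge_def)
  with c(2) eventually_gauge show ?thesis
  proof eventually_elim
    case (elim \<epsilon>)
    have "\<bar>a \<epsilon>\<bar> \<le> (c * \<rho> \<epsilon>) * \<rho> \<epsilon> ^ N" using elim by (simp add: abs_mult)
    also have "\<dots> \<le> 1 * \<rho> \<epsilon> ^ N"
      using elim c(1) by (intro mult_right_mono) (auto simp: field_simps)
    finally show ?case by simp
  qed
qed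

lemma negl_netI:
  assumes "\<And>N. eventually (\<lambda>\<epsilon>. \<bar>a \<epsilon>\<bar> \<le> \<rho> \<epsilon> ^ N) (at_right 0)"
  shows "negl_net \<rho> a"
  unfolding negl_net_def
proof
  fix N :: nat
  show "a \<in> O[at_right 0](\<lambda>\<epsilon>. \<rho> \<epsilon> ^ N)"
    using eventually_elim2[OF assms[of N] eventually_gauge] by (intro bigoI[of _ 1]) auto
qed

end

section \<open>Classes as sets of representatives\<close>

text \<open>Serves to replace cosets by a membership test on differences, the form in which classes
  are handled from here on.\<close>

lemma gen_class_eq_Collect:
  "gen_class \<rho> E p J u = {v. (\<lambda>\<epsilon>. v \<epsilon> - u \<epsilon>) \<in> negligible \<rho> E p J}"
proof -
  have "v = (\<lambda>\<epsilon>. (v \<epsilon> - u \<epsilon>) + u \<epsilon>)" for v by simp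
  then show ?thesis
    unfolding gen_class_def a_r_coset_def' moderate_module_def by auto
qed

text \<open>Generalized numbers are the instance in which every space is the real line and every
  seminorm the absolute value, so facts about \<open>gen_class\<close> carry over to them.\<close>

lemma gen_real_class_eq_gen_class:
  "gen_real_class \<rho> = gen_class \<rho> (\<lambda>_. UNIV) (\<lambda>_ _ x. \<bar>x\<bar>) UNIV"
  by (rule ext)
    (simp add: gen_real_class_def gen_class_def a_r_coset_def' moderate_module_def moderate_ring_def)

lemma gen_leD: "gen_le x y \<Longrightarrow> a \<in> x \<Longrightarrow> \<exists>b\<in>y. eventually (\<lambda>\<epsilon>. a \<epsilon> \<le> b \<epsilon>) (at_right 0)"
  by (simp add: gen_le_def)

lemma carrier_gen_module:
  "carrier (gen_module \<rho> E p J) = gen_class \<rho> E p J ` moderate \<rho> E p J"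
  by (auto simp: gen_module_def A_RCOSETS_def' gen_class_def moderate_module_def)

lemma carrier_gen_real: "carrier (gen_real \<rho>) = gen_real_class \<rho> ` moderate_real \<rho>"
  by (auto simp: gen_real_def FactRing_def A_RCOSETS_def' gen_real_class_def moderate_ring_def)

section \<open>Nets and classes over a family of seminormed spaces\<close>

locale gauged_family = gauged \<rho> for \<rho> +
  fixes E :: "real \<Rightarrow> 'a::real_vector set" and p :: "real \<Rightarrow> nat \<Rightarrow> 'a \<Rightarrow> real"
  assumes family: "lc_family E p"
begin

lemma subspace_E: "\<epsilon> \<in> ind \<Longrightarrow> subspace (E \<epsilon>)"
  using family by (simp add: lc_family_def)

lemma seminorm_p: "\<epsilon> \<in> ind \<Longrightarrow> seminorm_on (E \<epsilon>) (p \<epsilon> n)"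
  using family by (simp add: lc_family_def)

lemma p_nonneg: "\<epsilon> \<in> ind \<Longrightarrow> x \<in> E \<epsilon> \<Longrightarrow> 0 \<le> p \<epsilon> n x"
  using seminorm_p[of \<epsilon> n] by (auto simp: seminorm_on_def)

lemma p_add: "\<epsilon> \<in> ind \<Longrightarrow> x \<in> E \<epsilon> \<Longrightarrow> y \<in> E \<epsilon> \<Longrightarrow> p \<epsilon> n (x + y) \<le> p \<epsilon> n x + p \<epsilon> n y"
  using seminorm_p[of \<epsilon> n] by (auto simp: seminorm_on_def)

lemma p_scale: "\<epsilon> \<in> ind \<Longrightarrow> x \<in> E \<epsilon> \<Longrightarrow> p \<epsilon> n (c *\<^sub>R x) = \<bar>c\<bar> * p \<epsilon> n x"
  using seminorm_p[of \<epsilon> n] by (auto simp: seminorm_on_def)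

lemma p_0: "\<epsilon> \<in> ind \<Longrightarrow> p \<epsilon> n 0 = 0"
  using p_scale[of \<epsilon> 0 n 0] subspace_0[OF subspace_E] by auto

lemma p_minus: "\<epsilon> \<in> ind \<Longrightarrow> x \<in> E \<epsilon> \<Longrightarrow> p \<epsilon> n (- x) = p \<epsilon> n x"
  using p_scale[of \<epsilon> x n "- 1"] by simp

lemma Pi_add: "u \<in> Pi ind E \<Longrightarrow> v \<in> Pi ind E \<Longrightarrow> (\<lambda>\<epsilon>. u \<epsilon> + v \<epsilon>) \<in> Pi ind E"
  using subspace_E by (auto intro: subspace_add)

lemma Pi_scale: "u \<in> Pi ind E \<Longrightarrow> (\<lambda>\<epsilon>. a \<epsilon> *\<^sub>R u \<epsilon>) \<in> Pi ind E"
  using subspace_E by (auto intro: subspace_scale)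

lemma eventually_p_add:
  assumes "u \<in> Pi ind E" "v \<in> Pi ind E"
  shows "eventually (\<lambda>\<epsilon>. \<bar>p \<epsilon> n (u \<epsilon> + v \<epsilon>)\<bar> \<le> p \<epsilon> n (u \<epsilon>) + p \<epsilon> n (v \<epsilon>)) (at_right 0)"
  using eventually_ind
proof eventually_elim
  case (elim \<epsilon>)
  then have "u \<epsilon> \<in> E \<epsilon>" "v \<epsilon> \<in> E \<epsilon>" using assms by blast+
  moreover from this have "u \<epsilon> + v \<epsilon> \<in> E \<epsilon>" using subspace_E[OF elim] by (intro subspace_add)
  ultimately show ?case
    using elim p_add[of \<epsilon> "u \<epsilon>" "v \<epsilon>" n] p_nonneg[of \<epsilon> "u \<epsilon> + v \<epsilon>" n] by simp
qed

lemma eventually_p_scale: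
  assumes "u \<in> Pi ind E"
  shows "eventually (\<lambda>\<epsilon>. \<bar>p \<epsilon> n (a \<epsilon> *\<^sub>R u \<epsilon>)\<bar> \<le> \<bar>a \<epsilon>\<bar> * p \<epsilon> n (u \<epsilon>)) (at_right 0)"
  using eventually_ind
proof eventually_elim
  case (elim \<epsilon>)
  then have "u \<epsilon> \<in> E \<epsilon>" using assms by blast
  then show ?case using elim by (simp add: p_scale p_nonneg abs_mult)
qed

lemma moderate_add:
  assumes "u \<in> moderate \<rho> E p J" "v \<in> moderate \<rho> E p J"
  shows "(\<lambda>\<epsilon>. u \<epsilon> + v \<epsilon>) \<in> moderate \<rho> E p J"
  using assms unfolding moderate_iff
  by (intro conjI ballI Pi_add mod_net_mono[OF mod_net_add eventually_p_add]) auto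

lemma moderate_scale:
  assumes "mod_net \<rho> a" "u \<in> moderate \<rho> E p J"
  shows "(\<lambda>\<epsilon>. a \<epsilon> *\<^sub>R u \<epsilon>) \<in> moderate \<rho> E p J"
  using assms unfolding moderate_iff
  by (intro conjI ballI Pi_scale mod_net_mono[OF mod_net_mult eventually_p_scale]) auto

lemma negligible_add:
  assumes "u \<in> negligible \<rho> E p J" "v \<in> negligible \<rho> E p J"
  shows "(\<lambda>\<epsilon>. u \<epsilon> + v \<epsilon>) \<in> negligible \<rho> E p J"
  using assms unfolding negligible_iff
  by (intro conjI ballI Pi_add negl_net_mono[OF negl_net_add eventually_p_add]) auto

lemma negligible_scale:
  assumes "mod_net \<rho> a" "u \<in> negligible \<rho> E p J"
  shows "(\<lambda>\<epsilon>. a \<epsilon> *\<^sub>R u \<epsilon>) \<in> negligible \<rho> E p J"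
proof -
  have "negl_net \<rho> (\<lambda>\<epsilon>. \<bar>a \<epsilon>\<bar> * p \<epsilon> n (u \<epsilon>))" if "n \<in> J" for n
    using negl_net_mult[of "\<lambda>\<epsilon>. p \<epsilon> n (u \<epsilon>)" "\<lambda>\<epsilon>. \<bar>a \<epsilon>\<bar>"] assms that
    by (simp add: negligible_iff mult.commute)
  then show ?thesis
    using assms(2) unfolding negligible_iff
    by (intro conjI ballI Pi_scale negl_net_mono[OF _ eventually_p_scale]) auto
qed

lemma negligible_scale_moderate:
  assumes "negl_net \<rho> a" "u \<in> moderate \<rho> E p J"
  shows "(\<lambda>\<epsilon>. a \<epsilon> *\<^sub>R u \<epsilon>) \<in> negligible \<rho> E p J"
  using assms unfolding moderate_iff negligible_iff
  by (intro conjI ballI Pi_scale negl_net_mono[OF negl_net_mult eventually_p_scale]) auto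

lemma negligible_minus:
  assumes "u \<in> negligible \<rho> E p J"
  shows "(\<lambda>\<epsilon>. - u \<epsilon>) \<in> negligible \<rho> E p J"
  using negligible_scale[OF mod_net_const[of \<rho> "- 1"] assms] by simp

lemma negligible_diff:
  assumes "u \<in> negligible \<rho> E p J" "v \<in> negligible \<rho> E p J"
  shows "(\<lambda>\<epsilon>. u \<epsilon> - v \<epsilon>) \<in> negligible \<rho> E p J"
  using negligible_add[OF assms(1) negligible_minus[OF assms(2)]] by simp

text \<open>A class depends only on the germ of its nets at \<open>0\<close>. This permits repairing
  a representative at the indices where it lacks a property that holds eventually.\<close>

lemma negligible_eventually_0:
  assumes "u \<in> Pi ind E" "eventually (\<lambda>\<epsilon>. u \<epsilon> = 0) (at_right 0)"
  shows "u \<in> negligible \<rho> E p J"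
  unfolding negligible_iff
proof (intro conjI ballI)
  fix n
  have "eventually (\<lambda>\<epsilon>. \<bar>p \<epsilon> n (u \<epsilon>)\<bar> \<le> 0) (at_right 0)"
    using assms(2) eventually_ind by eventually_elim (simp add: p_0)
  then show "negl_net \<rho> (\<lambda>\<epsilon>. p \<epsilon> n (u \<epsilon>))" by (rule negl_net_mono[OF negl_net_0])
qed fact

lemma negligible_0: "(\<lambda>_. 0) \<in> negligible \<rho> E p J"
  by (rule negligible_eventually_0) (auto intro: subspace_0 subspace_E)

lemma negligible_moderate: "u \<in> negligible \<rho> E p J \<Longrightarrow> u \<in> moderate \<rho> E p J"
  by (auto simp: negligible_iff moderate_iff intro: negl_net_mod_net)

lemma gen_class_self: "u \<in> gen_class \<rho> E p J u"
  by (simp add: gen_class_eq_Collect negligible_0)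

lemma gen_class_eqI:
  assumes "(\<lambda>\<epsilon>. u \<epsilon> - v \<epsilon>) \<in> negligible \<rho> E p J"
  shows "gen_class \<rho> E p J u = gen_class \<rho> E p J v"
proof -
  have "(\<lambda>\<epsilon>. w \<epsilon> - v \<epsilon>) \<in> negligible \<rho> E p J \<longleftrightarrow> (\<lambda>\<epsilon>. w \<epsilon> - u \<epsilon>) \<in> negligible \<rho> E p J" for w
    using negligible_add[OF _ assms, of "\<lambda>\<epsilon>. w \<epsilon> - u \<epsilon>"]
      negligible_diff[OF _ assms, of "\<lambda>\<epsilon>. w \<epsilon> - v \<epsilon>"] by auto
  then show ?thesis by (simp add: gen_class_eq_Collect)
qed

lemma gen_class_moderate:
  assumes "u \<in> moderate \<rho> E p J" "v \<in> gen_class \<rho> E p J u"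
  shows "v \<in> moderate \<rho> E p J"
  using moderate_add[OF assms(1) negligible_moderate, of "\<lambda>\<epsilon>. v \<epsilon> - u \<epsilon>"] assms(2)
  by (simp add: gen_class_eq_Collect)

text \<open>For maps defined on classes as unions over all representatives: independence of the
  representative makes the union collapse to one term.\<close>

lemma UN_gen_class:
  assumes "\<And>v. v \<in> gen_class \<rho> E p J u \<Longrightarrow> T v = T u"
  shows "(\<Union>v\<in>gen_class \<rho> E p J u. T v) = T u"
  using assms gen_class_self by blast

text \<open>Only the addition of \<open>R\<close> is fixed, so that one computation serves both
  \<open>moderate_module\<close> and \<open>moderate_ring\<close>.\<close>

lemma set_add_gen_class:
  assumes "\<And>u v. u \<oplus>\<^bsub>R\<^esub> v = (\<lambda>\<epsilon>. u \<epsilon> + v \<epsilon>)"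
  shows "gen_class \<rho> E p J u <+>\<^bsub>R\<^esub> gen_class \<rho> E p J v = gen_class \<rho> E p J (\<lambda>\<epsilon>. u \<epsilon> + v \<epsilon>)"
proof (intro equalityI subsetI)
  fix w assume "w \<in> gen_class \<rho> E p J u <+>\<^bsub>R\<^esub> gen_class \<rho> E p J v"
  then obtain a b where ab: "(\<lambda>\<epsilon>. a \<epsilon> - u \<epsilon>) \<in> negligible \<rho> E p J"
    "(\<lambda>\<epsilon>. b \<epsilon> - v \<epsilon>) \<in> negligible \<rho> E p J" "w = (\<lambda>\<epsilon>. a \<epsilon> + b \<epsilon>)"
    using assms by (auto simp: set_add_def' gen_class_eq_Collect)
  with negligible_add[OF ab(1,2)] show "w \<in> gen_class \<rho> E p J (\<lambda>\<epsilon>. u \<epsilon> + v \<epsilon>)"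
    by (simp add: gen_class_eq_Collect algebra_simps)
next
  fix w assume "w \<in> gen_class \<rho> E p J (\<lambda>\<epsilon>. u \<epsilon> + v \<epsilon>)"
  \<comment> \<open>The whole deviation is put into the first summand, with \<open>v\<close> itself
    as the second.\<close>
  then have "(\<lambda>\<epsilon>. w \<epsilon> - v \<epsilon>) \<in> gen_class \<rho> E p J u"
    by (simp add: gen_class_eq_Collect algebra_simps)
  moreover have "w = (\<lambda>\<epsilon>. w \<epsilon> - v \<epsilon>) \<oplus>\<^bsub>R\<^esub> v" using assms by simp
  ultimately show "w \<in> gen_class \<rho> E p J u <+>\<^bsub>R\<^esub> gen_class \<rho> E p J v"
    using gen_class_self unfolding set_add_def' by blast
qed

lemma add_gen_class:
  "gen_class \<rho> E p J u \<oplus>\<^bsub>gen_module \<rho> E p J\<^esub> gen_class \<rho> E p J v = gen_class \<rho> E p J (\<lambda>\<epsilon>. u \<epsilon> + v \<epsilon>)"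
  by (simp add: gen_module_def moderate_module_def set_add_gen_class)

end

section \<open>Arithmetic and order of generalized numbers\<close>

sublocale gauged \<subseteq> real: gauged_family \<rho> "\<lambda>_. UNIV" "\<lambda>_ _ x. \<bar>x\<bar>"
  by unfold_locales (auto simp: lc_family_def seminorm_on_def abs_mult)

context gauged
begin

lemma gen_real_class_eq_Collect: "gen_real_class \<rho> a = {b. negl_net \<rho> (\<lambda>\<epsilon>. b \<epsilon> - a \<epsilon>)}"
  by (simp add: gen_real_class_eq_gen_class gen_class_eq_Collect)

lemma gen_real_class_eqI:
  assumes "negl_net \<rho> (\<lambda>\<epsilon>. a \<epsilon> - b \<epsilon>)"
  shows "gen_real_class \<rho> a = gen_real_class \<rho> b"
  using real.gen_class_eqI[where J = UNIV] assms by (simp add: gen_real_class_eq_gen_class)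

lemma add_gen_real_class:
  "gen_real_class \<rho> a \<oplus>\<^bsub>gen_real \<rho>\<^esub> gen_real_class \<rho> b = gen_real_class \<rho> (\<lambda>\<epsilon>. a \<epsilon> + b \<epsilon>)"
  by (simp add: gen_real_def FactRing_def gen_real_class_eq_gen_class moderate_ring_def
      real.set_add_gen_class)

text \<open>Independence of representatives rests on
  \<open>c * d - a * b = (c - a) * d + (d - b) * a\<close>, where each term is a negligible net
  times a moderate one.\<close>

lemma mult_gen_real_class:
  assumes "mod_net \<rho> a" "mod_net \<rho> b"
  shows "gen_real_class \<rho> a \<otimes>\<^bsub>gen_real \<rho>\<^esub> gen_real_class \<rho> b = gen_real_class \<rho> (\<lambda>\<epsilon>. a \<epsilon> * b \<epsilon>)"
proof -
  let ?cl = "gen_class \<rho> (\<lambda>_. UNIV) (\<lambda>_ _ x::real. \<bar>x\<bar>) UNIV"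
  have eq: "?cl (\<lambda>\<epsilon>. c \<epsilon> * d \<epsilon>) = ?cl (\<lambda>\<epsilon>. a \<epsilon> * b \<epsilon>)" if "c \<in> ?cl a" "d \<in> ?cl b" for c d
  proof (rule real.gen_class_eqI)
    have cd: "negl_net \<rho> (\<lambda>\<epsilon>. c \<epsilon> - a \<epsilon>)" "negl_net \<rho> (\<lambda>\<epsilon>. d \<epsilon> - b \<epsilon>)"
      using that by (auto simp: gen_class_eq_Collect)
    have "mod_net \<rho> d" using real.gen_class_moderate[OF _ that(2)] assms(2) by simp
    from negl_net_add[OF negl_net_mult[OF cd(1) this] negl_net_mult[OF cd(2) assms(1)]]
    show "(\<lambda>\<epsilon>. c \<epsilon> * d \<epsilon> - a \<epsilon> * b \<epsilon>) \<in> negligible_real \<rho>"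
      by (simp add: algebra_simps)
  qed
  have "gen_real_class \<rho> a \<otimes>\<^bsub>gen_real \<rho>\<^esub> gen_real_class \<rho> b
      = (\<Union>c\<in>?cl a. \<Union>d\<in>?cl b. ?cl (\<lambda>\<epsilon>. c \<epsilon> * d \<epsilon>))"
    unfolding gen_real_class_eq_gen_class[symmetric]
    by (simp add: gen_real_def FactRing_def rcoset_mult_def gen_real_class_def moderate_ring_def)
  also have "\<dots> = ?cl (\<lambda>\<epsilon>. a \<epsilon> * b \<epsilon>)"
    using eq real.gen_class_self by blast
  finally show ?thesis by (simp add: gen_real_class_eq_gen_class)
qed

text \<open>Passing to another representative \<open>c\<close> of the left side adds the negligible
  net \<open>c - a\<close>, which can be moved into the error term on the right. Hence one pair of
  representatives, compared up to a negligible error, decides the order.\<close>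

lemma gen_le_class_iff:
  "gen_le (gen_real_class \<rho> a) (gen_real_class \<rho> b) \<longleftrightarrow>
    (\<exists>n. negl_net \<rho> n \<and> eventually (\<lambda>\<epsilon>. a \<epsilon> \<le> b \<epsilon> + n \<epsilon>) (at_right 0))"
proof
  assume "gen_le (gen_real_class \<rho> a) (gen_real_class \<rho> b)"
  then obtain c where "negl_net \<rho> (\<lambda>\<epsilon>. c \<epsilon> - b \<epsilon>)" "eventually (\<lambda>\<epsilon>. a \<epsilon> \<le> c \<epsilon>) (at_right 0)"
    using gen_leD[of _ _ a] by (force simp: gen_real_class_eq_Collect negl_net_0)
  then show "\<exists>n. negl_net \<rho> n \<and> eventually (\<lambda>\<epsilon>. a \<epsilon> \<le> b \<epsilon> + n \<epsilon>) (at_right 0)"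
    by (intro exI[of _ "\<lambda>\<epsilon>. c \<epsilon> - b \<epsilon>"]) simp
next
  assume "\<exists>n. negl_net \<rho> n \<and> eventually (\<lambda>\<epsilon>. a \<epsilon> \<le> b \<epsilon> + n \<epsilon>) (at_right 0)"
  then obtain n where n: "negl_net \<rho> n" "eventually (\<lambda>\<epsilon>. a \<epsilon> \<le> b \<epsilon> + n \<epsilon>) (at_right 0)" by blast
  show "gen_le (gen_real_class \<rho> a) (gen_real_class \<rho> b)"
    unfolding gen_le_def gen_real_class_eq_Collect
  proof safe
    fix c assume "negl_net \<rho> (\<lambda>\<epsilon>. c \<epsilon> - a \<epsilon>)"
    from negl_net_add[OF this n(1)]
    show "\<exists>d\<in>{d. negl_net \<rho> (\<lambda>\<epsilon>. d \<epsilon> - b \<epsilon>)}. eventually (\<lambda>\<epsilon>. c \<epsilon> \<le> d \<epsilon>) (at_right 0)"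
      using n(2) by (intro bexI[of _ "\<lambda>\<epsilon>. b \<epsilon> + (c \<epsilon> - a \<epsilon> + n \<epsilon>)"]) (auto elim!: eventually_mono)
  qed
qed

text \<open>Comparing the representative \<open>0\<close> of zero with \<open>C\<close> yields a
  member of \<open>C\<close> that is eventually nonnegative, and every member of a class of moderate
  nets is itself a moderate representative.\<close>

lemma gen_pos_class:
  assumes "gen_pos \<rho> C"
  obtains c where "C = gen_real_class \<rho> c" "mod_net \<rho> c" "eventually (\<lambda>\<epsilon>. 0 \<le> c \<epsilon>) (at_right 0)"
proof -
  have "gen_le (negligible_real \<rho>) C" "C \<in> carrier (gen_real \<rho>)"
    using assms by (auto simp: gen_pos_def gen_real_def FactRing_def Units_def)
  then obtain c where c: "c \<in> C" "eventually (\<lambda>\<epsilon>. 0 \<le> c \<epsilon>) (at_right 0)"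
    using gen_leD[of "negligible_real \<rho>" C "\<lambda>_. 0"] by (auto simp: negl_net_0)
  obtain c' where c': "mod_net \<rho> c'" "C = gen_real_class \<rho> c'"
    using \<open>C \<in> carrier (gen_real \<rho>)\<close> by (auto simp: carrier_gen_real)
  show ?thesis
  proof
    show "C = gen_real_class \<rho> c"
      using c(1) c'(2) gen_real_class_eqI by (auto simp: gen_real_class_eq_Collect)
    show "mod_net \<rho> c"
      using real.gen_class_moderate[of c' UNIV c] c(1) c' by (simp add: gen_real_class_eq_gen_class)
  qed fact
qed

end

section \<open>Scalar multiplication, seminorms and internal sets in terms of
  representatives\<close>

context gauged_family
begin

text \<open>The difference \<open>b v - a u\<close> splits as \<open>(b - a) v + a (v - u)\<close>:
  a negligible scalar acting on a moderate net, plus a moderate scalar acting on a negligible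
  one.\<close>

lemma smult_gen_class:
  assumes "mod_net \<rho> a" "u \<in> moderate \<rho> E p J"
  shows "gen_real_class \<rho> a \<odot>\<^bsub>gen_module \<rho> E p J\<^esub> gen_class \<rho> E p J u
    = gen_class \<rho> E p J (\<lambda>\<epsilon>. a \<epsilon> *\<^sub>R u \<epsilon>)"
proof -
  have eq: "gen_class \<rho> E p J (\<lambda>\<epsilon>. b \<epsilon> *\<^sub>R v \<epsilon>) = gen_class \<rho> E p J (\<lambda>\<epsilon>. a \<epsilon> *\<^sub>R u \<epsilon>)"
    if b: "b \<in> gen_real_class \<rho> a" and v: "v \<in> gen_class \<rho> E p J u" for b v
  proof (rule gen_class_eqI)
    have "(\<lambda>\<epsilon>. (b \<epsilon> - a \<epsilon>) *\<^sub>R v \<epsilon> + a \<epsilon> *\<^sub>R (v \<epsilon> - u \<epsilon>)) \<in> negligible \<rho> E p J"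
      using b v gen_class_moderate[OF assms(2) v] assms(1)
      by (intro negligible_add negligible_scale negligible_scale_moderate)
        (auto simp: gen_real_class_eq_Collect gen_class_eq_Collect)
    then show "(\<lambda>\<epsilon>. b \<epsilon> *\<^sub>R v \<epsilon> - a \<epsilon> *\<^sub>R u \<epsilon>) \<in> negligible \<rho> E p J"
      by (simp add: algebra_simps)
  qed
  have "a \<in> gen_real_class \<rho> a"
    by (simp add: gen_real_class_eq_Collect negl_net_0)
  then have ne: "gen_real_class \<rho> a \<noteq> {}" "gen_class \<rho> E p J u \<noteq> {}"
    using gen_class_self by blast+
  have "gen_real_class \<rho> a \<odot>\<^bsub>gen_module \<rho> E p J\<^esub> gen_class \<rho> E p J u
      = (\<Union>b\<in>gen_real_class \<rho> a. \<Union>v\<in>gen_class \<rho> E p J u. gen_class \<rho> E p J (\<lambda>\<epsilon>. b \<epsilon> *\<^sub>R v \<epsilon>))"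
    by (simp add: gen_module_def moderate_module_def)
  also have "\<dots> = (\<Union>b\<in>gen_real_class \<rho> a. \<Union>v\<in>gen_class \<rho> E p J u. gen_class \<rho> E p J (\<lambda>\<epsilon>. a \<epsilon> *\<^sub>R u \<epsilon>))"
    by (intro SUP_cong refl eq)
  also have "\<dots> = gen_class \<rho> E p J (\<lambda>\<epsilon>. a \<epsilon> *\<^sub>R u \<epsilon>)"
    using ne by simp
  finally show ?thesis .
qed

text \<open>The reverse triangle inequality bounds the change of \<open>p \<epsilon> i\<close>
  between two representatives by its value on their difference.\<close>

lemma gen_seminorm_class:
  assumes "u \<in> moderate \<rho> E p J" "i \<in> J"
  shows "gen_seminorm \<rho> p i (gen_class \<rho> E p J u) = gen_real_class \<rho> (\<lambda>\<epsilon>. p \<epsilon> i (u \<epsilon>))"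
  unfolding gen_seminorm_def
proof (intro UN_gen_class gen_real_class_eqI)
  fix v assume v: "v \<in> gen_class \<rho> E p J u"
  then have negl: "negl_net \<rho> (\<lambda>\<epsilon>. p \<epsilon> i (v \<epsilon> - u \<epsilon>))"
    using assms(2) by (simp add: gen_class_eq_Collect negligible_iff)
  have in_E: "u \<in> Pi ind E" "v \<in> Pi ind E"
    using assms(1) gen_class_moderate[OF assms(1) v] by (auto simp: moderate_iff)
  have "eventually (\<lambda>\<epsilon>. \<bar>p \<epsilon> i (v \<epsilon>) - p \<epsilon> i (u \<epsilon>)\<bar> \<le> p \<epsilon> i (v \<epsilon> - u \<epsilon>)) (at_right 0)"
    using eventually_ind
  proof eventually_elim
    case (elim \<epsilon>)
    then have uv: "u \<epsilon> \<in> E \<epsilon>" "v \<epsilon> \<in> E \<epsilon>" "v \<epsilon> - u \<epsilon> \<in> E \<epsilon>" "u \<epsilon> - v \<epsilon> \<in> E \<epsilon>"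
      using in_E by (blast intro: subspace_diff subspace_E)+
    have "p \<epsilon> i (v \<epsilon>) \<le> p \<epsilon> i (v \<epsilon> - u \<epsilon>) + p \<epsilon> i (u \<epsilon>)"
      using p_add[OF elim uv(3,1), of i] by simp
    moreover have "p \<epsilon> i (u \<epsilon>) \<le> p \<epsilon> i (v \<epsilon> - u \<epsilon>) + p \<epsilon> i (v \<epsilon>)"
      using p_add[OF elim uv(4,2), of i] p_minus[OF elim uv(3), of i] by simp
    ultimately show ?case by linarith
  qed
  then show "negl_net \<rho> (\<lambda>\<epsilon>. p \<epsilon> i (v \<epsilon>) - p \<epsilon> i (u \<epsilon>))"
    by (rule negl_net_mono[OF negl])
qed

text \<open>Membership in \<open>internal\<close> only gives
  \<open>v \<epsilon> \<in> F \<epsilon>\<close> for small \<open>\<epsilon>\<close>, whereas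
  \<open>represented_by\<close> speaks of nets that lie in \<open>F\<close> at every index.
  Resetting the other values to \<open>0\<close>, which belongs to each \<open>F \<epsilon>\<close>,
  closes this gap without changing the class.\<close>

lemma internal_representative:
  assumes F: "\<And>\<epsilon>. \<epsilon> \<in> ind \<Longrightarrow> subspace (F \<epsilon>) \<and> F \<epsilon> \<subseteq> E \<epsilon>" and x: "x \<in> internal \<rho> E p J F"
  obtains u where "u \<in> moderate \<rho> E p J" "u \<in> Pi ind F" "x = gen_class \<rho> E p J u"
proof -
  obtain w v where w: "w \<in> moderate \<rho> E p J" "x = gen_class \<rho> E p J w"
    and v: "v \<in> x" "eventually (\<lambda>\<epsilon>. v \<epsilon> \<in> F \<epsilon>) (at_right 0)"
    using x by (auto simp: internal_def carrier_gen_module)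
  have v_mod: "v \<in> moderate \<rho> E p J" and x_eq: "x = gen_class \<rho> E p J v"
    using gen_class_moderate[OF w(1)] v(1) w(2) gen_class_eqI[of v w J]
    by (auto simp: gen_class_eq_Collect)
  define u where "u \<epsilon> = (if v \<epsilon> \<in> F \<epsilon> then v \<epsilon> else 0)" for \<epsilon>
  have "(\<lambda>\<epsilon>. u \<epsilon> - v \<epsilon>) \<in> negligible \<rho> E p J"
  proof (rule negligible_eventually_0)
    show "(\<lambda>\<epsilon>. u \<epsilon> - v \<epsilon>) \<in> Pi ind E"
      using v_mod subspace_0[OF subspace_E] by (auto simp: u_def moderate_iff Pi_iff intro!: subspace_neg subspace_E)
    show "eventually (\<lambda>\<epsilon>. u \<epsilon> - v \<epsilon> = 0) (at_right 0)"
      using v(2) by eventually_elim (simp add: u_def)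
  qed
  then have "u \<in> gen_class \<rho> E p J v" by (simp add: gen_class_eq_Collect)
  show ?thesis
  proof
    show "u \<in> moderate \<rho> E p J" by (rule gen_class_moderate) fact+
    show "u \<in> Pi ind F" using F by (auto simp: u_def subspace_0)
    show "x = gen_class \<rho> E p J u" unfolding x_eq by (rule gen_class_eqI[symmetric]) fact
  qed
qed

end

section \<open>From generalized inequalities to bounds at single indices, and back\<close>

text \<open>If \<open>q u > 0\<close>, then \<open>u\<close> is scaled into the unit ball. If
  \<open>q u = 0\<close>, all multiples of \<open>u\<close> stay in the ball, so a positive value
  \<open>g u\<close> would exceed \<open>b\<close> after scaling.\<close>

lemma functional_le_seminorm:
  assumes F: "subspace F" and q: "seminorm_on F q" and g: "linear_functional_on F g"
    and bound: "\<And>w. w \<in> F \<Longrightarrow> q w \<le> 1 \<Longrightarrow> g w \<le> b" and u: "u \<in> F"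
  shows "g u \<le> b * q u"
proof -
  have scale: "q (t *\<^sub>R u) = \<bar>t\<bar> * q u" "g (t *\<^sub>R u) = t * g u" "t *\<^sub>R u \<in> F" for t
    using q g u F by (auto simp: seminorm_on_def linear_functional_on_def subspace_scale)
  have "q u \<ge> 0" using q u by (auto simp: seminorm_on_def)
  then consider "q u > 0" | "q u = 0" by linarith
  then show ?thesis
  proof cases
    case 1
    with bound[OF scale(3)[of "1 / q u"]] show ?thesis by (simp add: scale field_simps)
  next
    case 2
    have "\<not> g u > 0"
    proof
      assume "g u > 0"
      with bound[OF scale(3)[of "(\<bar>b\<bar> + 1) / g u"]] 2 show False by (simp add: scale)
    qed
    with 2 show ?thesis by simp
  qed
qed

context gauged_family
begin

text \<open>
  If the bound fails for arbitrarily small indices, unit-ball vectors at which it fails form a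
  moderate net that violates the generalized inequality.
\<close>

lemma eventually_uniform_bound:
  assumes F: "\<And>\<epsilon>. \<epsilon> \<in> ind \<Longrightarrow> subspace (F \<epsilon>) \<and> F \<epsilon> \<subseteq> E \<epsilon>"
    and rep: "represented_by \<rho> E p {i} F gr g"
    and c: "mod_net \<rho> c"
    and le: "\<And>x. x \<in> internal \<rho> E p {i} F \<Longrightarrow>
      gen_le (g x) (gen_real_class \<rho> c \<otimes>\<^bsub>gen_real \<rho>\<^esub> gen_seminorm \<rho> p i x)"
  shows "eventually (\<lambda>\<epsilon>. \<forall>w\<in>F \<epsilon>. p \<epsilon> i w \<le> 1 \<longrightarrow> gr \<epsilon> w \<le> c \<epsilon> * p \<epsilon> i w + \<rho> \<epsilon> ^ m) (at_right 0)"
proof -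
  define bad where "bad \<epsilon> w \<longleftrightarrow>
    w \<in> F \<epsilon> \<and> p \<epsilon> i w \<le> 1 \<and> \<not> gr \<epsilon> w \<le> c \<epsilon> * p \<epsilon> i w + \<rho> \<epsilon> ^ m" for \<epsilon> w
  \<comment> \<open>The default \<open>0\<close> lies in \<open>F \<epsilon>\<close> and in the unit
    ball, so \<open>w\<close> is an admissible net also at indices without a bad vector.\<close>
  define w where "w \<epsilon> = (if \<exists>v. bad \<epsilon> v then SOME v. bad \<epsilon> v else 0)" for \<epsilon>
  have w_bad: "bad \<epsilon> (w \<epsilon>)" if "bad \<epsilon> v" for \<epsilon> v
    using someI[of "bad \<epsilon>" v] that by (auto simp: w_def)
  have w_F: "w \<epsilon> \<in> F \<epsilon>" and w_le: "p \<epsilon> i (w \<epsilon>) \<le> 1" if \<epsilon>: "\<epsilon> \<in> ind" for \<epsilon>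
  proof -
    have "w \<epsilon> \<in> F \<epsilon> \<and> p \<epsilon> i (w \<epsilon>) \<le> 1"
    proof (cases "\<exists>v. bad \<epsilon> v")
      case True
      then show ?thesis using w_bad by (auto simp: bad_def)
    next
      case False
      then show ?thesis using F[OF \<epsilon>] p_0[OF \<epsilon>] by (simp add: w_def subspace_0)
    qed
    then show "w \<epsilon> \<in> F \<epsilon>" "p \<epsilon> i (w \<epsilon>) \<le> 1" by auto
  qed
  have "w \<in> Pi ind E" using w_F F by blast
  have "eventually (\<lambda>\<epsilon>. \<bar>p \<epsilon> i (w \<epsilon>)\<bar> \<le> 1) (at_right 0)"
    using eventually_ind
  proof eventually_elim
    case (elim \<epsilon>)
    then show ?case using w_le[OF elim] p_nonneg[OF elim, of "w \<epsilon>" i] \<open>w \<in> Pi ind E\<close> by force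
  qed
  from mod_net_mono[OF mod_net_const this] \<open>w \<in> Pi ind E\<close>
  have w_mod: "w \<in> moderate \<rho> E p {i}" by (simp add: moderate_iff)
  then have w_PiF: "w \<in> moderate \<rho> E p {i} \<inter> Pi ind F" using w_F by blast
  let ?x = "gen_class \<rho> E p {i} w"
  have "eventually (\<lambda>\<epsilon>. w \<epsilon> \<in> F \<epsilon>) (at_right 0)"
    using eventually_ind by eventually_elim (rule w_F)
  then have "?x \<in> internal \<rho> E p {i} F"
    using w_mod gen_class_self by (auto simp: internal_def carrier_gen_module)
  from le[OF this]
  have "gen_le (gen_real_class \<rho> (\<lambda>\<epsilon>. gr \<epsilon> (w \<epsilon>))) (gen_real_class \<rho> (\<lambda>\<epsilon>. c \<epsilon> * p \<epsilon> i (w \<epsilon>)))"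
    using rep w_PiF w_mod c
    by (simp add: represented_by_def gen_seminorm_class mult_gen_real_class moderate_iff)
  then obtain n where n: "negl_net \<rho> n"
    "eventually (\<lambda>\<epsilon>. gr \<epsilon> (w \<epsilon>) \<le> c \<epsilon> * p \<epsilon> i (w \<epsilon>) + n \<epsilon>) (at_right 0)"
    by (auto simp: gen_le_class_iff)
  \<comment> \<open>Once \<open>n \<epsilon> \<le> \<rho> \<epsilon> ^ m\<close>, the vector
    \<open>w \<epsilon>\<close> is not bad. Since \<open>w\<close> picks a bad vector wherever one
    exists, no vector is bad at such an index.\<close>
  from n(2) eventually_negl_net_le[OF n(1), of m] show ?thesis
  proof eventually_elim
    case (elim \<epsilon>)
    have "\<not> bad \<epsilon> (w \<epsilon>)" using elim by (auto simp: bad_def)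
    then have "\<not> bad \<epsilon> v" for v using w_bad by blast
    then show ?case unfolding bad_def by blast
  qed
qed

text \<open>A bound by a moderate multiple of \<open>p \<epsilon> i\<close> is a quantitative form
  of continuity: moderate nets have moderate images and negligible differences have negligible
  images, so the functionals descend to classes.\<close>

lemma represented_functional:
  assumes lin: "\<And>\<epsilon>. \<epsilon> \<in> ind \<Longrightarrow> linear_functional_on (E \<epsilon>) (fr \<epsilon>)"
    and k: "mod_net \<rho> k"
    and bound: "eventually (\<lambda>\<epsilon>. \<forall>x\<in>E \<epsilon>. fr \<epsilon> x \<le> k \<epsilon> * p \<epsilon> i x) (at_right 0)"
  obtains f where "represented_by \<rho> E p {i} E fr f"
    "gen_linear_on \<rho> (gen_module \<rho> E p {i}) (carrier (gen_module \<rho> E p {i})) f"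
proof -
  have fr_add: "fr \<epsilon> (x + y) = fr \<epsilon> x + fr \<epsilon> y" if "\<epsilon> \<in> ind" "x \<in> E \<epsilon>" "y \<in> E \<epsilon>" for \<epsilon> x y
    using lin[OF that(1)] that by (auto simp: linear_functional_on_def)
  have fr_scale: "fr \<epsilon> (a *\<^sub>R x) = a * fr \<epsilon> x" if "\<epsilon> \<in> ind" "x \<in> E \<epsilon>" for \<epsilon> x a
    using lin[OF that(1)] that by (auto simp: linear_functional_on_def)
  have fr_minus: "fr \<epsilon> (- x) = - fr \<epsilon> x" if "\<epsilon> \<in> ind" "x \<in> E \<epsilon>" for \<epsilon> x
    using fr_scale[OF that, of "- 1"] by simp
  have fr_diff: "fr \<epsilon> (x - y) = fr \<epsilon> x - fr \<epsilon> y" if "\<epsilon> \<in> ind" "x \<in> E \<epsilon>" "y \<in> E \<epsilon>" for \<epsilon> x y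
    using fr_add[of \<epsilon> x "- y"] fr_minus[of \<epsilon> y] that subspace_neg[OF subspace_E] by simp
  \<comment> \<open>The one-sided bound is applied to \<open>u\<close> and to
    \<open>- u\<close>.\<close>
  have abs_bound: "eventually (\<lambda>\<epsilon>. \<bar>fr \<epsilon> (u \<epsilon>)\<bar> \<le> k \<epsilon> * p \<epsilon> i (u \<epsilon>)) (at_right 0)"
    if "u \<in> Pi ind E" for u
    using bound eventually_ind
  proof eventually_elim
    case (elim \<epsilon>)
    then have u: "u \<epsilon> \<in> E \<epsilon>" "- u \<epsilon> \<in> E \<epsilon>" using that subspace_neg[OF subspace_E] by blast+
    have "fr \<epsilon> (u \<epsilon>) \<le> k \<epsilon> * p \<epsilon> i (u \<epsilon>)" "fr \<epsilon> (- u \<epsilon>) \<le> k \<epsilon> * p \<epsilon> i (- u \<epsilon>)"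
      using elim(1) u by blast+
    then show ?case using elim(2) u by (simp add: fr_minus p_minus)
  qed
  have moderate: "mod_net \<rho> (\<lambda>\<epsilon>. fr \<epsilon> (u \<epsilon>))" if "u \<in> moderate \<rho> E p {i}" for u
    using that by (intro mod_net_mono[OF mod_net_mult[OF k] abs_bound]) (auto simp: moderate_iff)
  have negligible: "negl_net \<rho> (\<lambda>\<epsilon>. fr \<epsilon> (u \<epsilon>) - fr \<epsilon> (v \<epsilon>))"
    if uv: "u \<in> Pi ind E" "v \<in> Pi ind E" "(\<lambda>\<epsilon>. u \<epsilon> - v \<epsilon>) \<in> negligible \<rho> E p {i}" for u v
  proof (rule negl_net_mono)
    show "negl_net \<rho> (\<lambda>\<epsilon>. k \<epsilon> * p \<epsilon> i (u \<epsilon> - v \<epsilon>))"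
      using negl_net_mult[OF _ k, of "\<lambda>\<epsilon>. p \<epsilon> i (u \<epsilon> - v \<epsilon>)"] uv(3)
      by (simp add: negligible_iff mult.commute)
    have "(\<lambda>\<epsilon>. u \<epsilon> - v \<epsilon>) \<in> Pi ind E" using uv(3) by (simp add: negligible_iff)
    from abs_bound[OF this] eventually_ind
    show "eventually (\<lambda>\<epsilon>. \<bar>fr \<epsilon> (u \<epsilon>) - fr \<epsilon> (v \<epsilon>)\<bar> \<le> k \<epsilon> * p \<epsilon> i (u \<epsilon> - v \<epsilon>)) (at_right 0)"
    proof eventually_elim
      case (elim \<epsilon>)
      then have "u \<epsilon> \<in> E \<epsilon>" "v \<epsilon> \<in> E \<epsilon>" using uv by blast+
      then show ?case using elim by (simp add: fr_diff)
    qed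
  qed
  \<comment> \<open>A union over all representatives, so that none has to be chosen.\<close>
  define f where "f x = (\<Union>u\<in>x. gen_real_class \<rho> (\<lambda>\<epsilon>. fr \<epsilon> (u \<epsilon>)))" for x
  have f_class: "f (gen_class \<rho> E p {i} u) = gen_real_class \<rho> (\<lambda>\<epsilon>. fr \<epsilon> (u \<epsilon>))"
    if u: "u \<in> moderate \<rho> E p {i}" for u
    unfolding f_def
  proof (intro UN_gen_class gen_real_class_eqI negligible)
    fix v assume v: "v \<in> gen_class \<rho> E p {i} u"
    show "v \<in> Pi ind E" using gen_class_moderate[OF u v] by (simp add: moderate_iff)
    show "u \<in> Pi ind E" using u by (simp add: moderate_iff)
    show "(\<lambda>\<epsilon>. v \<epsilon> - u \<epsilon>) \<in> negligible \<rho> E p {i}" using v by (simp add: gen_class_eq_Collect)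
  qed
  show ?thesis
  proof
    show "represented_by \<rho> E p {i} E fr f"
      using lin moderate negligible f_class by (auto simp: represented_by_def)
    show "gen_linear_on \<rho> (gen_module \<rho> E p {i}) (carrier (gen_module \<rho> E p {i})) f"
      unfolding gen_linear_on_def carrier_gen_module carrier_gen_real
    proof (intro conjI ballI Pi_I; clarify)
      fix u assume "u \<in> moderate \<rho> E p {i}"
      then show "f (gen_class \<rho> E p {i} u) \<in> gen_real_class \<rho> ` moderate_real \<rho>"
        using f_class moderate by auto
    next
      fix u v assume u: "u \<in> moderate \<rho> E p {i}" and v: "v \<in> moderate \<rho> E p {i}"
      \<comment> \<open>Additivity is available at indices in \<open>ind\<close> only, so the two
        nets are compared as classes and not as functions.\<close>
      have "gen_real_class \<rho> (\<lambda>\<epsilon>. fr \<epsilon> (u \<epsilon> + v \<epsilon>)) = gen_real_class \<rho> (\<lambda>\<epsilon>. fr \<epsilon> (u \<epsilon>) + fr \<epsilon> (v \<epsilon>))"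
      proof (intro gen_real_class_eqI negl_net_mono[OF negl_net_0])
        show "eventually (\<lambda>\<epsilon>. \<bar>fr \<epsilon> (u \<epsilon> + v \<epsilon>) - (fr \<epsilon> (u \<epsilon>) + fr \<epsilon> (v \<epsilon>))\<bar> \<le> 0) (at_right 0)"
          using eventually_ind
        proof eventually_elim
          case (elim \<epsilon>)
          then have "u \<epsilon> \<in> E \<epsilon>" "v \<epsilon> \<in> E \<epsilon>" using u v unfolding moderate_iff by blast+
          then show ?case using elim by (simp add: fr_add)
        qed
      qed
      then show "f (gen_class \<rho> E p {i} u \<oplus>\<^bsub>gen_module \<rho> E p {i}\<^esub> gen_class \<rho> E p {i} v)
        = f (gen_class \<rho> E p {i} u) \<oplus>\<^bsub>gen_real \<rho>\<^esub> f (gen_class \<rho> E p {i} v)"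
        using u v by (simp add: add_gen_class f_class moderate_add add_gen_real_class)
    next
      fix a u assume "a \<in> moderate_real \<rho>" and u: "u \<in> moderate \<rho> E p {i}"
      then have a: "mod_net \<rho> a" by simp
      have "gen_real_class \<rho> (\<lambda>\<epsilon>. fr \<epsilon> (a \<epsilon> *\<^sub>R u \<epsilon>)) = gen_real_class \<rho> (\<lambda>\<epsilon>. a \<epsilon> * fr \<epsilon> (u \<epsilon>))"
      proof (intro gen_real_class_eqI negl_net_mono[OF negl_net_0])
        show "eventually (\<lambda>\<epsilon>. \<bar>fr \<epsilon> (a \<epsilon> *\<^sub>R u \<epsilon>) - a \<epsilon> * fr \<epsilon> (u \<epsilon>)\<bar> \<le> 0) (at_right 0)"
          using eventually_ind
        proof eventually_elim
          case (elim \<epsilon>)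
          then have "u \<epsilon> \<in> E \<epsilon>" using u unfolding moderate_iff by blast
          then show ?case using elim by (simp add: fr_scale)
        qed
      qed
      then show "f (gen_real_class \<rho> a \<odot>\<^bsub>gen_module \<rho> E p {i}\<^esub> gen_class \<rho> E p {i} u)
        = gen_real_class \<rho> a \<otimes>\<^bsub>gen_real \<rho>\<^esub> f (gen_class \<rho> E p {i} u)"
        using a u moderate[OF u]
        by (simp add: smult_gen_class f_class moderate_scale mult_gen_real_class)
    qed
  qed
qed

end

section \<open>Extension at each index and passage to classes\<close>

theorem theorem8:
  fixes \<rho> :: "real \<Rightarrow> real"
    and E F :: "real \<Rightarrow> 'a::real_vector set"
    and p :: "real \<Rightarrow> nat \<Rightarrow> 'a \<Rightarrow> real"
    and gr :: "real \<Rightarrow> 'a \<Rightarrow> real"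
    and g gi :: "(real \<Rightarrow> 'a) set \<Rightarrow> (real \<Rightarrow> real) set"
    and i :: nat
    and C :: "(real \<Rightarrow> real) set"
  assumes "gauge \<rho>"
    and "lc_family E p"
    and "\<And>\<epsilon>. \<epsilon> \<in> ind \<Longrightarrow> subspace (F \<epsilon>) \<and> F \<epsilon> \<subseteq> E \<epsilon>"
    and "submodule (internal \<rho> E p UNIV F) (gen_real \<rho>) (gen_module \<rho> E p UNIV)"
    and "represented_by \<rho> E p UNIV F gr g"
    and "gen_linear_on \<rho> (gen_module \<rho> E p UNIV) (internal \<rho> E p UNIV F) g"
    and "gen_pos \<rho> C"
    and "represented_by \<rho> E p {i} F gr gi"
    and "\<And>x. x \<in> internal \<rho> E p {i} F \<Longrightarrow>
           gen_le (gi x) (C \<otimes>\<^bsub>gen_real \<rho>\<^esub> gen_seminorm \<rho> p i x)"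
  shows "\<exists>fr f. represented_by \<rho> E p {i} E fr f
    \<and> gen_linear_on \<rho> (gen_module \<rho> E p {i}) (carrier (gen_module \<rho> E p {i})) f
    \<and> (\<forall>x\<in>internal \<rho> E p {i} F. f x = gi x)
    \<and> (\<forall>x\<in>carrier (gen_module \<rho> E p {i}).
          gen_le (f x) (C \<otimes>\<^bsub>gen_real \<rho>\<^esub> gen_seminorm \<rho> p i x))"
proof -
  interpret gauged_family \<rho> E p
    using assms(1,2) by unfold_locales
  note F = assms(3) and rep = assms(8)
  obtain c where C: "C = gen_real_class \<rho> c" and c: "mod_net \<rho> c"
    and c_nonneg: "eventually (\<lambda>\<epsilon>. 0 \<le> c \<epsilon>) (at_right 0)"
    using gen_pos_class[OF assms(7)] .
  define S where "S \<epsilon> = gr \<epsilon> ` {w \<in> F \<epsilon>. p \<epsilon> i w \<le> 1}" for \<epsilon>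
  \<comment> \<open>The exact supremum does not depend on \<open>m\<close>. The bounds
    \<open>c \<epsilon> + \<rho> \<epsilon> ^ m\<close> hold only for \<open>\<epsilon>\<close>
    small depending on \<open>m\<close>, while one extension has to serve all \<open>m\<close> at
    once.\<close>
  define b where "b \<epsilon> = Sup (S \<epsilon>)" for \<epsilon>
  have gr_lin: "linear_functional_on (F \<epsilon>) (gr \<epsilon>)" if "\<epsilon> \<in> ind" for \<epsilon>
    using rep that by (simp add: represented_by_def)
  \<comment> \<open>This makes the supremum one of a nonempty set and, where
    \<open>S \<epsilon>\<close> is bounded, gives \<open>0 \<le> b \<epsilon>\<close>, so that
    \<open>b \<epsilon> * p \<epsilon> i\<close> is a seminorm.\<close>
  have S_0: "0 \<in> S \<epsilon>" if \<epsilon>: "\<epsilon> \<in> ind" for \<epsilon>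
  proof -
    have 0: "0 \<in> F \<epsilon>" using F[OF \<epsilon>] by (simp add: subspace_0)
    have "gr \<epsilon> (0 *\<^sub>R 0) = 0 * gr \<epsilon> 0"
      using gr_lin[OF \<epsilon>] 0 unfolding linear_functional_on_def by blast
    then show ?thesis using 0 p_0[OF \<epsilon>] by (force simp: S_def)
  qed
  have bound: "eventually (\<lambda>\<epsilon>. \<forall>w\<in>F \<epsilon>. p \<epsilon> i w \<le> 1 \<longrightarrow> gr \<epsilon> w \<le> c \<epsilon> * p \<epsilon> i w + \<rho> \<epsilon> ^ m) (at_right 0)" for m
    by (rule eventually_uniform_bound[OF F rep c assms(9)[unfolded C]])
  \<comment> \<open>Nonnegativity of \<open>c \<epsilon>\<close> allows
    \<open>p \<epsilon> i w\<close> to be replaced by its upper bound \<open>1\<close>.\<close>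
  have S_le: "eventually (\<lambda>\<epsilon>. \<forall>y\<in>S \<epsilon>. y \<le> c \<epsilon> + \<rho> \<epsilon> ^ m) (at_right 0)" for m
    using bound[of m] c_nonneg eventually_ind
  proof eventually_elim
    case (elim \<epsilon>)
    show ?case
    proof
      fix y assume "y \<in> S \<epsilon>"
      then obtain w where w: "w \<in> F \<epsilon>" "p \<epsilon> i w \<le> 1" "y = gr \<epsilon> w" by (auto simp: S_def)
      then have "y \<le> c \<epsilon> * p \<epsilon> i w + \<rho> \<epsilon> ^ m" using elim(1) by blast
      also have "c \<epsilon> * p \<epsilon> i w \<le> c \<epsilon> * 1" using elim(2) w(2) by (intro mult_left_mono)
      finally show "y \<le> c \<epsilon> + \<rho> \<epsilon> ^ m" by simp
    qed
  qed
  \<comment> \<open>\<open>b \<epsilon>\<close> is meaningful as a supremum only where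
    \<open>S \<epsilon>\<close> is bounded above. The exponent \<open>0\<close> in
    \<open>S_le\<close> already shows that this holds eventually.\<close>
  define good where "good \<epsilon> \<longleftrightarrow> \<epsilon> \<in> ind \<and> bdd_above (S \<epsilon>)" for \<epsilon>
  have ev_good: "eventually good (at_right 0)"
    using S_le[of 0] eventually_ind by eventually_elim (auto simp: good_def bdd_above_def)
  define is_ext where "is_ext \<epsilon> h \<longleftrightarrow> linear_functional_on (E \<epsilon>) h \<and> (\<forall>x\<in>F \<epsilon>. h x = gr \<epsilon> x)
    \<and> (\<forall>x\<in>E \<epsilon>. h x \<le> b \<epsilon> * p \<epsilon> i x)" for \<epsilon> h
  have ext: "\<exists>h. is_ext \<epsilon> h" if "good \<epsilon>" for \<epsilon>
  proof -
    have \<epsilon>: "\<epsilon> \<in> ind" and bdd: "bdd_above (S \<epsilon>)" using that by (auto simp: good_def)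
    have b: "y \<le> b \<epsilon>" if "y \<in> S \<epsilon>" for y
      unfolding b_def using that bdd by (rule cSup_upper)
    have "0 \<le> b \<epsilon>" using b[OF S_0[OF \<epsilon>]] .
    have "seminorm_on (F \<epsilon>) (p \<epsilon> i)"
      using seminorm_p[OF \<epsilon>, of i] F[OF \<epsilon>] unfolding seminorm_on_def by blast
    then have "gr \<epsilon> x \<le> b \<epsilon> * p \<epsilon> i x" if "x \<in> F \<epsilon>" for x
      using F[OF \<epsilon>] gr_lin[OF \<epsilon>] that
      by (intro functional_le_seminorm[where F = "F \<epsilon>"] b) (auto simp: S_def)
    moreover have "seminorm_on (E \<epsilon>) (\<lambda>x. b \<epsilon> * p \<epsilon> i x)"
      unfolding seminorm_on_def
    proof (intro conjI ballI allI)
      fix x y assume "x \<in> E \<epsilon>" "y \<in> E \<epsilon>"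
      then show "b \<epsilon> * p \<epsilon> i (x + y) \<le> b \<epsilon> * p \<epsilon> i x + b \<epsilon> * p \<epsilon> i y"
        using mult_left_mono[OF p_add[OF \<epsilon>] \<open>0 \<le> b \<epsilon>\<close>] by (simp add: distrib_left)
    qed (use \<epsilon> \<open>0 \<le> b \<epsilon>\<close> in \<open>auto simp: p_nonneg p_scale\<close>)
    ultimately show ?thesis
      using Hahn_Banach_seminorm[OF subspace_E[OF \<epsilon>] _ _ _ gr_lin[OF \<epsilon>], of "\<lambda>x. b \<epsilon> * p \<epsilon> i x"] F[OF \<epsilon>]
      unfolding is_ext_def by metis
  qed
  \<comment> \<open>The zero functional at the remaining indices keeps \<open>fr \<epsilon>\<close>
    linear everywhere, as \<open>represented_by\<close> demands for all of \<open>ind\<close>.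
    Extension and domination are claimed at good indices only, which determine the classes.\<close>
  define fr where "fr \<epsilon> = (if good \<epsilon> then SOME h. is_ext \<epsilon> h else (\<lambda>_. 0))" for \<epsilon>
  have fr: "is_ext \<epsilon> (fr \<epsilon>)" if "good \<epsilon>" for \<epsilon>
    using someI_ex[OF ext[OF that]] that by (simp add: fr_def)
  have fr_lin: "linear_functional_on (E \<epsilon>) (fr \<epsilon>)" for \<epsilon>
    using fr[of \<epsilon>] by (cases "good \<epsilon>") (auto simp: is_ext_def fr_def linear_functional_on_def)
  \<comment> \<open>The truncation at \<open>0\<close> is essential: \<open>b \<epsilon>\<close> may
    lie far below \<open>c \<epsilon>\<close>, and only the excess above \<open>c \<epsilon>\<close>
    is controlled by the powers of \<open>\<rho> \<epsilon>\<close>.\<close>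
  define n where "n \<epsilon> = max 0 (b \<epsilon> - c \<epsilon>)" for \<epsilon>
  have n: "negl_net \<rho> n"
  proof (rule negl_netI)
    fix N
    show "eventually (\<lambda>\<epsilon>. \<bar>n \<epsilon>\<bar> \<le> \<rho> \<epsilon> ^ N) (at_right 0)"
      using S_le[of N] eventually_ind
    proof eventually_elim
      case (elim \<epsilon>)
      have "b \<epsilon> \<le> c \<epsilon> + \<rho> \<epsilon> ^ N"
        unfolding b_def using elim S_0 by (intro cSup_least) auto
      then show ?case using gauge_range[OF elim(2)] by (simp add: n_def)
    qed
  qed
  have fr_le: "eventually (\<lambda>\<epsilon>. \<forall>x\<in>E \<epsilon>. fr \<epsilon> x \<le> (c \<epsilon> + n \<epsilon>) * p \<epsilon> i x) (at_right 0)"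
    using ev_good
  proof eventually_elim
    case (elim \<epsilon>)
    show ?case
    proof
      fix x assume x: "x \<in> E \<epsilon>"
      have "fr \<epsilon> x \<le> b \<epsilon> * p \<epsilon> i x" using fr[OF elim] x by (simp add: is_ext_def)
      also have "\<dots> \<le> (c \<epsilon> + n \<epsilon>) * p \<epsilon> i x"
        using elim x by (intro mult_right_mono p_nonneg) (auto simp: n_def good_def)
      finally show "fr \<epsilon> x \<le> (c \<epsilon> + n \<epsilon>) * p \<epsilon> i x" .
    qed
  qed
  obtain f where f: "represented_by \<rho> E p {i} E fr f"
    and f_lin: "gen_linear_on \<rho> (gen_module \<rho> E p {i}) (carrier (gen_module \<rho> E p {i})) f"
    using represented_functional[OF fr_lin mod_net_add[OF c negl_net_mod_net[OF n]] fr_le] .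
  have f_class: "f (gen_class \<rho> E p {i} u) = gen_real_class \<rho> (\<lambda>\<epsilon>. fr \<epsilon> (u \<epsilon>))"
    if "u \<in> moderate \<rho> E p {i}" for u
    using f that by (auto simp: represented_by_def moderate_iff)
  have f_eq: "f x = gi x" if x: "x \<in> internal \<rho> E p {i} F" for x
  proof -
    \<comment> \<open>A representative lying in \<open>F\<close> at every index is needed, both to
      evaluate \<open>gi\<close> through \<open>gr\<close> and to compare \<open>fr\<close> with
      \<open>gr\<close>.\<close>
    obtain u where u: "u \<in> moderate \<rho> E p {i}" "u \<in> Pi ind F" "x = gen_class \<rho> E p {i} u"
      using internal_representative[OF F x] .
    have "eventually (\<lambda>\<epsilon>. \<bar>fr \<epsilon> (u \<epsilon>) - gr \<epsilon> (u \<epsilon>)\<bar> \<le> 0) (at_right 0)"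
      using ev_good
    proof eventually_elim
      case (elim \<epsilon>)
      then have "u \<epsilon> \<in> F \<epsilon>" using u(2) unfolding good_def by blast
      then show ?case using fr[OF elim] by (simp add: is_ext_def)
    qed
    then have "gen_real_class \<rho> (\<lambda>\<epsilon>. fr \<epsilon> (u \<epsilon>)) = gen_real_class \<rho> (\<lambda>\<epsilon>. gr \<epsilon> (u \<epsilon>))"
      by (intro gen_real_class_eqI negl_net_mono[OF negl_net_0])
    also have "\<dots> = gi x" using rep u unfolding represented_by_def by blast
    finally show ?thesis using f_class[OF u(1)] u(3) by simp
  qed
  have f_le: "gen_le (f x) (C \<otimes>\<^bsub>gen_real \<rho>\<^esub> gen_seminorm \<rho> p i x)"
    if x: "x \<in> carrier (gen_module \<rho> E p {i})" for x
  proof -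
    obtain u where u: "u \<in> moderate \<rho> E p {i}" "x = gen_class \<rho> E p {i} u"
      using x by (auto simp: carrier_gen_module)
    have p_u: "mod_net \<rho> (\<lambda>\<epsilon>. p \<epsilon> i (u \<epsilon>))" and u_E: "u \<in> Pi ind E"
      using u(1) by (auto simp: moderate_iff)
    have "eventually (\<lambda>\<epsilon>. fr \<epsilon> (u \<epsilon>) \<le> c \<epsilon> * p \<epsilon> i (u \<epsilon>) + n \<epsilon> * p \<epsilon> i (u \<epsilon>)) (at_right 0)"
      using fr_le eventually_ind
    proof eventually_elim
      case (elim \<epsilon>)
      then have "u \<epsilon> \<in> E \<epsilon>" using u_E by blast
      then show ?case using elim(1) by (simp add: distrib_right)
    qed
    \<comment> \<open>The error is a negligible net times the moderate net
      \<open>p \<epsilon> i (u \<epsilon>)\<close>. The order of generalized numbers absorbs it, so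
      the bound holds with \<open>C\<close> itself although the functionals are dominated only with
      factor \<open>c \<epsilon> + n \<epsilon>\<close>.\<close>
    with negl_net_mult[OF n p_u]
    have "gen_le (gen_real_class \<rho> (\<lambda>\<epsilon>. fr \<epsilon> (u \<epsilon>))) (gen_real_class \<rho> (\<lambda>\<epsilon>. c \<epsilon> * p \<epsilon> i (u \<epsilon>)))"
      unfolding gen_le_class_iff by blast
    then show ?thesis
      using u c p_u by (simp add: f_class C gen_seminorm_class mult_gen_real_class)
  qed
  show ?thesis using f f_lin f_eq f_le by blast
qed

end
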